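(* Let $d\in\mathbb{R}^n$, $G=A-\operatorname{Diag}(d)$, and let $S^*,T^*$ be the optimal solutions, given by $S^*=U_2\operatorname{Diag}(s^* )U_2^T$ and $T^*=U_1\operatorname{Diag}(t^* )U_1^T$ (see context), of the dual semidefinite program $$\max\ \tfrac12\operatorname{trace}S+\tfrac12\operatorname{trace}T\quad\text{s.t.}\quad I_{k-1}\otimes S+T\otimes I_{n-1}\preceq\widehat B\otimes\widehat G,\ \ S\preceq0,\ \ S\in\mathcal{S}^{n-1},\ T\in\mathcal{S}^{k-1}.$$ Then a lower bound on $\operatorname{cut}(m)$ is obtained from the following quadratic program: $$\operatorname{cut}(m)\ \ge\ p^*_{QP}(G)=\min_{X\in\mathcal{D}}\ \tfrac12\operatorname{vec}(X)^T\tilde Q\operatorname{vec}(X)+\tfrac12\left\langle\lambda(\widehat G),\begin{pmatrix}\lambda(\widehat B)\\0\end{pmatrix}\right\rangle_-,$$ where $$\tilde Q:=B\otimes G-M^{-1}\otimes VS^*V^T-\tilde M^{-1}WT^*W^T\tilde M^{-1}\otimes I_n .$$ This quadratic program is implicitly convex: $\tilde Q$ is positive semidefinite on the tangent space of $\mathcal{E}$, i.e. $\operatorname{vec}(Y)^T\tilde Q\operatorname{vec}(Y)\ge0$ for all $Y\in\mathbb{R}^{n\times k}$ with $Ye=0$ and $Y^Te=0$.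
   Context: Setting: an undirected (simple) graph with node set $N=\{1,\dots,n\}$, nonempty edge set and adjacency matrix $A$; $e$ is the all-ones vector of appropriate size, $\operatorname{Diag}(v)$ is the diagonal matrix with diagonal $v$, $\operatorname{vec}$ stacks the columns of a matrix, $\otimes$ is the Kronecker product, $\mathcal{S}^t$ is the space of real symmetric $t\times t$ matrices and $\preceq$ is the Loewner order. $k>2$ is an integer and $m=(m_1,\dots,m_k)^T$ is a vector of positive integers with $m_1+\dots+m_k=n$. $B=\begin{bmatrix} ee^T-I_{k-1} & 0\\ 0&0\end{bmatrix}\in\mathcal{S}^k$, $M=\operatorname{Diag}(m)$, $\tilde m=(\sqrt{m_1},\dots,\sqrt{m_k})^T$, $\tilde M=\operatorname{Diag}(\tilde m)$. $\operatorname{cut}(m)$ is the minimum, over all ordered partitions $(S_1,\dots,S_k)$ of $N$ with $|S_i|=m_i$, of the number of edges whose endpoints lie in two distinct sets among $S_1,\dots,S_{k-1}$. $\mathcal{E}=\{X\in\mathbb{R}^{n\times k}:Xe=e,\ X^Te=m\}$ and $\mathcal{D}=\{X\in\mathcal{E}:X_{ij}\ge0\ \forall i,j\}$. $V\in\mathbb{R}^{n\times(n-1)}$ and $W\in\mathbb{R}^{k\times(k-1)}$ are such that $\begin{bmatrix}\frac1{\sqrt n}e&V\end{bmatrix}$ and $\begin{bmatrix}\frac1{\sqrt n}\tilde m&W\end{bmatrix}$ are orthogonal. $\widehat X=\frac1nem^T$, $\widehat G=V^TGV$, $\widehat B=W^T\tilde MB\tilde MW$, $\alpha=\frac1{n^2}(e^TGe)(m^TBm)$,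 $C=2V^TG\widehat XB\tilde MW$. For symmetric $D$, $\lambda(D)$ is the vector of its eigenvalues in nonincreasing order. For $x,y\in\mathbb{R}^r$, $\langle x,y\rangle_-=\min_\phi\sum_i x_{\phi(i)}y_i$ over permutations $\phi$ of $\{1,\dots,r\}$; $\begin{pmatrix}\lambda(D)\\0\end{pmatrix}$ is padded with zeros to the required length. Construction of $S^*,T^*$: let $\widehat B=U_1\operatorname{Diag}(\lambda)U_1^T$ and $\widehat G=U_2\operatorname{Diag}(\sigma)U_2^T$ be orthogonal eigenvalue decompositions, and let $(s^*,t^* )\in\mathbb{R}^{n-1}\times\mathbb{R}^{k-1}$ be an optimal solution of the linear program: maximize $\frac12e^Ts+\frac12e^Tt$ subject to $t_i+s_j\le\lambda_i\sigma_j$ for $i=1,\dots,k-1$, $j=1,\dots,n-1$, and $s_j\le0$ for all $j$. Then $S^*=U_2\operatorname{Diag}(s^* )U_2^T$ and $T^*=U_1\operatorname{Diag}(t^* )U_1^T$ solve the dual semidefinite program in the claim. Definition of $p^*_{QP}(G)$: with $\widehat Q=\widehat B\otimes\widehat G-I_{k-1}\otimes S^*-T^*\otimes I_{n-1}$, $p^*_{QP}(G)$ is the optimal value of $$\min_{Z\in\mathbb{R}^{(n-1)\times(k-1)}}\ \tfrac12\left(\alpha+\operatorname{trace}CZ^T+\operatorname{vec}(Z)^T\widehat Q\operatorname{vec}(Z)+\left\langle\lambda(\widehat G),\begin{pmatrix}\lambda(\widehat B)\\0\end{pmatrix}\right\rangle_-\right)\ \ \text{s.t. } VZW^T\tilde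 M\ge-\widehat X\ \text{(entrywise)}.$$ *)

theory Defs
  imports
    "Jordan_Normal_Form.Char_Poly"
    "Jordan_Normal_Form.Gauss_Jordan_Elimination"
    "HOL-Combinatorics.Permutations"
    "HOL-Library.Disjoint_Sets"
    "HOL-Library.Multiset"
begin

text \<open>
  All index sets are zero-based: the nodes are \<open>0, \<dots>, n - 1\<close>, the parts of a partition are
  \<open>0, \<dots>, k - 1\<close> (so the distinguished last part has index \<open>k - 1\<close>), and \<open>k\<close> is
  \<^term>\<open>dim_vec m\<close> for the vector \<open>m\<close> of part sizes.
\<close>

section \<open>Matrix notions\<close>

definition ones_vec :: "nat \<Rightarrow> real vec" where
  "ones_vec r = vec r (\<lambda>_. 1)"

definition diag_of_vec :: "real vec \<Rightarrow> real mat" where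
  "diag_of_vec v = mat_diag (dim_vec v) (\<lambda>i. v $ i)"

definition outer_prod :: "real vec \<Rightarrow> real vec \<Rightarrow> real mat" where
  "outer_prod u v = mat (dim_vec u) (dim_vec v) (\<lambda>(i, j). u $ i * v $ j)"

definition trace_mat :: "real mat \<Rightarrow> real" where
  "trace_mat A = sum_list (diag_mat A)"

text \<open>Only meaningful for invertible arguments; \<^const>\<open>mat_inverse\<close> is \<^const>\<open>None\<close> otherwise.\<close>

definition inv_mat :: "real mat \<Rightarrow> real mat" where
  "inv_mat A = the (mat_inverse A)"

definition kron :: "real mat \<Rightarrow> real mat \<Rightarrow> real mat" (infixl "\<otimes>\<^sub>m" 70) where
  "A \<otimes>\<^sub>m B = mat (dim_row A * dim_row B) (dim_col A * dim_col B)
     (\<lambda>(i, j). A $$ (i div dim_row B, j div dim_col B) * B $$ (i mod dim_row B, j mod dim_col B))"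

text \<open>Stacking of the columns: entry \<open>(i, j)\<close> of \<open>X\<close> goes to position \<open>j * dim_row X + i\<close>.\<close>

definition vec_stack :: "real mat \<Rightarrow> real vec" where
  "vec_stack X = vec (dim_row X * dim_col X) (\<lambda>p. X $$ (p mod dim_row X, p div dim_row X))"

definition quad_form :: "real mat \<Rightarrow> real vec \<Rightarrow> real" where
  "quad_form Q x = x \<bullet> (Q *\<^sub>v x)"

definition sym_mat :: "nat \<Rightarrow> real mat set" where
  "sym_mat r = {A \<in> carrier_mat r r. transpose_mat A = A}"

definition psd :: "real mat \<Rightarrow> bool" where
  "psd A \<longleftrightarrow> A \<in> sym_mat (dim_row A) \<and> (\<forall>x \<in> carrier_vec (dim_row A). quad_form A x \<ge> 0)"

definition loewner_le :: "real mat \<Rightarrow> real mat \<Rightarrow> bool" (infix "\<preceq>\<^sub>L" 50) where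
  "A \<preceq>\<^sub>L B \<longleftrightarrow> dim_row A = dim_row B \<and> dim_col A = dim_col B \<and> psd (B - A)"

text \<open>
  Orthogonal in the usual sense. The library's \<^const>\<open>orthogonal_mat\<close> does not ask
  the columns to have norm one.
\<close>

definition orthogonal_matrix :: "real mat \<Rightarrow> bool" where
  "orthogonal_matrix Q \<longleftrightarrow> square_mat Q \<and> transpose_mat Q * Q = 1\<^sub>m (dim_col Q)"

definition prepend_col :: "real vec \<Rightarrow> real mat \<Rightarrow> real mat" where
  "prepend_col v A = mat_of_cols (dim_row A) (v # cols A)"

definition eig_decomp :: "real mat \<Rightarrow> real mat \<Rightarrow> real vec \<Rightarrow> bool" where
  "eig_decomp D U lam \<longleftrightarrow> U \<in> carrier_mat (dim_row D) (dim_row D) \<and> orthogonal_matrix U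
     \<and> lam \<in> carrier_vec (dim_row D) \<and> D = U * diag_of_vec lam * transpose_mat U"

text \<open>
  Real eigenvalues with their multiplicity as roots of the characteristic polynomial, in
  nonincreasing order. For symmetric \<open>D\<close> these are all eigenvalues, so that the vector has
  length \<^term>\<open>dim_row D\<close>.
\<close>

definition eigvals :: "real mat \<Rightarrow> real vec" where
  "eigvals D = vec_of_list (rev (sorted_list_of_multiset (proots (char_poly D))))"

definition pad_zeros :: "nat \<Rightarrow> real vec \<Rightarrow> real vec" where
  "pad_zeros r v = v @\<^sub>v 0\<^sub>v (r - dim_vec v)"

definition min_sprod :: "real vec \<Rightarrow> real vec \<Rightarrow> real" where
  "min_sprod x y =
     Min {(\<Sum>i<dim_vec y. x $ (\<phi> i) * y $ i) | \<phi>. \<phi> permutes {..<dim_vec y}}"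

definition is_min_value :: "real \<Rightarrow> ('a \<Rightarrow> real) \<Rightarrow> 'a set \<Rightarrow> bool" where
  "is_min_value p f F \<longleftrightarrow> (\<exists>x\<in>F. f x = p) \<and> (\<forall>x\<in>F. p \<le> f x)"


section \<open>Graphs and the minimum cut\<close>

definition simple_graph :: "nat \<Rightarrow> nat set set \<Rightarrow> bool" where
  "simple_graph n E \<longleftrightarrow> (\<forall>e\<in>E. e \<subseteq> {..<n} \<and> card e = 2)"

definition adjacency :: "nat \<Rightarrow> nat set set \<Rightarrow> real mat" where
  "adjacency n E = mat n n (\<lambda>(i, j). if {i, j} \<in> E then 1 else 0)"

definition ordered_partition :: "nat \<Rightarrow> nat vec \<Rightarrow> (nat \<Rightarrow> nat set) \<Rightarrow> bool" where
  "ordered_partition n m P \<longleftrightarrow> (\<Union>i<dim_vec m. P i) = {..<n}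
     \<and> disjoint_family_on P {..<dim_vec m} \<and> (\<forall>i<dim_vec m. card (P i) = m $ i)"

definition cut_edges :: "nat set set \<Rightarrow> nat \<Rightarrow> (nat \<Rightarrow> nat set) \<Rightarrow> nat set set" where
  "cut_edges E k P = {e \<in> E. \<exists>i<k - 1. \<exists>j<k - 1. i \<noteq> j \<and> (\<exists>u\<in>P i. \<exists>v\<in>P j. e = {u, v})}"

definition min_cut :: "nat \<Rightarrow> nat set set \<Rightarrow> nat vec \<Rightarrow> nat" where
  "min_cut n E m = Min {card (cut_edges E (dim_vec m) P) | P. ordered_partition n m P}"


section \<open>Data of the problem\<close>

definition Bmat :: "nat \<Rightarrow> real mat" where
  "Bmat k = four_block_mat (outer_prod (ones_vec (k - 1)) (ones_vec (k - 1)) - 1\<^sub>m (k - 1))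
     (0\<^sub>m (k - 1) 1) (0\<^sub>m 1 (k - 1)) (0\<^sub>m 1 1)"

definition real_vec :: "nat vec \<Rightarrow> real vec" where
  "real_vec m = map_vec real m"

definition sqrt_vec :: "nat vec \<Rightarrow> real vec" where
  "sqrt_vec m = map_vec (\<lambda>x. sqrt (real x)) m"

definition Mmat :: "nat vec \<Rightarrow> real mat" where
  "Mmat m = diag_of_vec (real_vec m)"

definition Mtilde :: "nat vec \<Rightarrow> real mat" where
  "Mtilde m = diag_of_vec (sqrt_vec m)"

definition Xhat :: "nat \<Rightarrow> nat vec \<Rightarrow> real mat" where
  "Xhat n m = (1 / real n) \<cdot>\<^sub>m outer_prod (ones_vec n) (real_vec m)"

definition Ghat :: "real mat \<Rightarrow> real mat \<Rightarrow> real mat" where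
  "Ghat V G = transpose_mat V * G * V"

definition Bhat :: "nat vec \<Rightarrow> real mat \<Rightarrow> real mat" where
  "Bhat m W = transpose_mat W * Mtilde m * Bmat (dim_vec m) * Mtilde m * W"

definition alpha :: "nat \<Rightarrow> nat vec \<Rightarrow> real mat \<Rightarrow> real" where
  "alpha n m G = 1 / (real n)\<^sup>2 * quad_form G (ones_vec n) * quad_form (Bmat (dim_vec m)) (real_vec m)"

definition Cmat :: "nat \<Rightarrow> nat vec \<Rightarrow> real mat \<Rightarrow> real mat \<Rightarrow> real mat \<Rightarrow> real mat" where
  "Cmat n m G V W =
     2 \<cdot>\<^sub>m (transpose_mat V * G * Xhat n m * Bmat (dim_vec m) * Mtilde m * W)"

definition affine_set :: "nat \<Rightarrow> nat vec \<Rightarrow> real mat set" where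
  "affine_set n m = {X \<in> carrier_mat n (dim_vec m).
     X *\<^sub>v ones_vec (dim_vec m) = ones_vec n \<and> transpose_mat X *\<^sub>v ones_vec n = real_vec m}"

definition nonneg_set :: "nat \<Rightarrow> nat vec \<Rightarrow> real mat set" where
  "nonneg_set n m = {X \<in> affine_set n m. \<forall>i<n. \<forall>j<dim_vec m. X $$ (i, j) \<ge> 0}"

definition tangent_space :: "nat \<Rightarrow> nat \<Rightarrow> real mat set" where
  "tangent_space n k = {Y \<in> carrier_mat n k.
     Y *\<^sub>v ones_vec k = 0\<^sub>v n \<and> transpose_mat Y *\<^sub>v ones_vec n = 0\<^sub>v k}"

definition eig_term :: "real mat \<Rightarrow> real mat \<Rightarrow> real" where
  "eig_term Gh Bh = min_sprod (eigvals Gh) (pad_zeros (dim_row Gh) (eigvals Bh))"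


section \<open>The linear program and the dual semidefinite program\<close>

definition lp_feasible :: "real vec \<Rightarrow> real vec \<Rightarrow> (real vec \<times> real vec) set" where
  "lp_feasible lam sig = {(s, t). s \<in> carrier_vec (dim_vec sig) \<and> t \<in> carrier_vec (dim_vec lam)
     \<and> (\<forall>i<dim_vec lam. \<forall>j<dim_vec sig. t $ i + s $ j \<le> lam $ i * sig $ j)
     \<and> (\<forall>j<dim_vec sig. s $ j \<le> 0)}"

definition lp_objective :: "real vec \<Rightarrow> real vec \<Rightarrow> real" where
  "lp_objective s t = 1/2 * (ones_vec (dim_vec s) \<bullet> s) + 1/2 * (ones_vec (dim_vec t) \<bullet> t)"

definition lp_optimal :: "real vec \<Rightarrow> real vec \<Rightarrow> real vec \<Rightarrow> real vec \<Rightarrow> bool" where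
  "lp_optimal lam sig s t \<longleftrightarrow> (s, t) \<in> lp_feasible lam sig
     \<and> (\<forall>(s', t') \<in> lp_feasible lam sig. lp_objective s' t' \<le> lp_objective s t)"

definition sdp_feasible :: "real mat \<Rightarrow> real mat \<Rightarrow> (real mat \<times> real mat) set" where
  "sdp_feasible Bh Gh = {(S, T). S \<in> sym_mat (dim_row Gh) \<and> T \<in> sym_mat (dim_row Bh)
     \<and> (1\<^sub>m (dim_row Bh) \<otimes>\<^sub>m S) + (T \<otimes>\<^sub>m 1\<^sub>m (dim_row Gh)) \<preceq>\<^sub>L Bh \<otimes>\<^sub>m Gh
     \<and> S \<preceq>\<^sub>L 0\<^sub>m (dim_row Gh) (dim_row Gh)}"

definition sdp_objective :: "real mat \<Rightarrow> real mat \<Rightarrow> real" where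
  "sdp_objective S T = 1/2 * trace_mat S + 1/2 * trace_mat T"

definition sdp_optimal :: "real mat \<Rightarrow> real mat \<Rightarrow> real mat \<Rightarrow> real mat \<Rightarrow> bool" where
  "sdp_optimal Bh Gh S T \<longleftrightarrow> (S, T) \<in> sdp_feasible Bh Gh
     \<and> (\<forall>(S', T') \<in> sdp_feasible Bh Gh. sdp_objective S' T' \<le> sdp_objective S T)"


section \<open>The quadratic programs\<close>

definition Qhat :: "real mat \<Rightarrow> real mat \<Rightarrow> real mat \<Rightarrow> real mat \<Rightarrow> real mat" where
  "Qhat Bh Gh S T =
     (Bh \<otimes>\<^sub>m Gh) - (1\<^sub>m (dim_row Bh) \<otimes>\<^sub>m S) - (T \<otimes>\<^sub>m 1\<^sub>m (dim_row Gh))"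

definition qp_feasible :: "nat \<Rightarrow> nat vec \<Rightarrow> real mat \<Rightarrow> real mat \<Rightarrow> real mat set" where
  "qp_feasible n m V W = {Z \<in> carrier_mat (n - 1) (dim_vec m - 1).
     \<forall>i<n. \<forall>j<dim_vec m. (V * Z * transpose_mat W * Mtilde m) $$ (i, j) \<ge> - (Xhat n m $$ (i, j))}"

definition qp_objective ::
  "nat \<Rightarrow> nat vec \<Rightarrow> real mat \<Rightarrow> real mat \<Rightarrow> real mat \<Rightarrow> real mat \<Rightarrow> real mat \<Rightarrow> real mat \<Rightarrow> real" where
  "qp_objective n m G V W S T Z =
     1/2 * (alpha n m G + trace_mat (Cmat n m G V W * transpose_mat Z)
       + quad_form (Qhat (Bhat m W) (Ghat V G) S T) (vec_stack Z)
       + eig_term (Ghat V G) (Bhat m W))"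

definition p_QP ::
  "nat \<Rightarrow> nat vec \<Rightarrow> real mat \<Rightarrow> real mat \<Rightarrow> real mat \<Rightarrow> real mat \<Rightarrow> real mat \<Rightarrow> real" where
  "p_QP n m G V W S T = (INF Z \<in> qp_feasible n m V W. qp_objective n m G V W S T Z)"

definition Qtilde ::
  "nat \<Rightarrow> nat vec \<Rightarrow> real mat \<Rightarrow> real mat \<Rightarrow> real mat \<Rightarrow> real mat \<Rightarrow> real mat \<Rightarrow> real mat" where
  "Qtilde n m G V W S T =
     (Bmat (dim_vec m) \<otimes>\<^sub>m G)
     - (inv_mat (Mmat m) \<otimes>\<^sub>m (V * S * transpose_mat V))
     - ((inv_mat (Mtilde m) * W * T * transpose_mat W * inv_mat (Mtilde m)) \<otimes>\<^sub>m 1\<^sub>m n)"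

end

theory Submission
  imports Defs "HOL-Analysis.Function_Topology"
begin

text \<open>
  Write \<open>\<mu>\<close> for the diagonal matrix of the square roots of the part sizes. The columns of \<open>V\<close>
  span the complement of the all-ones vector and those of \<open>W\<close> the complement of \<open>\<mu>\<one>\<close>, so the
  substitution \<open>X = Xhat + V Z W\<^sup>T \<mu>\<close> parametrises the affine set by \<open>Z\<close>
  (\<open>affine_set_eq_embed\<close>), and dropping the centre \<open>Xhat\<close> parametrises its tangent space. Since
  then \<open>V\<^sup>T X \<mu>\<^sup>-\<^sup>1 = Z W\<^sup>T\<close> and \<open>X \<mu>\<^sup>-\<^sup>1 W = V Z\<close>, the form of \<open>Qtilde\<close> at \<open>X\<close> is the form of \<open>Qhat\<close>
  at \<open>Z\<close> plus the linear and constant terms of the first program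
  (\<open>quad_form_Qtilde_embed\<close>). The two programs are thus the same problem in two coordinate
  systems. The minimum exists because nonnegative matrices with row sums one form a compact set.

  In the product of the eigenbases of \<open>Bhat\<close> and \<open>Ghat\<close> the matrix \<open>Qhat\<close> is diagonal, with the
  slacks of the linear program as its entries (\<open>quad_form_Qhat_diag\<close>). Feasibility of the linear
  program therefore gives both the semidefinite constraint and convexity on the tangent space.
  Conversely, the diagonals in the eigenbases of any feasible pair of the semidefinite program
  are feasible for the linear program with the same objective value (\<open>sdp_feasible_to_lp\<close>), which
  gives optimality of \<open>S\<close> and \<open>T\<close>.

  For the bound on the cut, let \<open>X\<close> be the indicator matrix of a partition. As \<open>X\<^sup>T X = \<mu>\<^sup>2\<close>, its
  coordinate matrix \<open>Z\<close> has orthonormal columns. Hence \<open>\<langle>T, Z\<^sup>T Z\<rangle>\<close> is the trace of \<open>T\<close>, and because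
  \<open>S\<close> is negative semidefinite, \<open>\<langle>S, Z Z\<^sup>T\<rangle>\<close> is at least the trace of \<open>S\<close>. The two traces sum to
  twice the value of the linear program, which is at least the minimal scalar product of the
  spectra: the linear program is the dual of an assignment problem with product costs, and
  explicit dual variables certify that its antisorted assignment is optimal
  (\<open>antisorted_potentials\<close>, \<open>eig_term_le_lp\<close>). So the corrections by \<open>S\<close> and \<open>T\<close> together
  with the eigenvalue term do not exceed zero, and what remains, half of \<open>\<langle>X, G X B\<rangle>\<close>, counts the cut edges.
\<close>

section \<open>Matrix algebra with the entrywise inner product\<close>

text \<open>Quadratic forms in stacked matrices become expressions in this inner product, where a factor
  can be moved to the other argument by transposition; no Kronecker products are left.\<close>

definition frob :: "real mat \<Rightarrow> real mat \<Rightarrow> real" where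
  "frob X Y = (\<Sum>i<dim_row X. \<Sum>j<dim_col X. X $$ (i, j) * Y $$ (i, j))"

lemma mult_mat_entry:
  assumes "i < dim_row A" "j < dim_col B" "dim_col A = dim_row B"
  shows "(A * B) $$ (i, j) = (\<Sum>l<dim_row B. A $$ (i, l) * B $$ (l, j))"
  using assms by (simp add: scalar_prod_def atLeast0LessThan)

text \<open>Side conditions on dimensions, unlike carrier conditions, are decided by the simplifier.\<close>

lemma mult_assoc_dims:
  fixes A B C :: "real mat"
  assumes "dim_col A = dim_row B" "dim_col B = dim_row C"
  shows "(A * B) * C = A * (B * C)"
  by (rule assoc_mult_mat[of A "dim_row A" "dim_row B" B "dim_row C" C "dim_col C"])
    (use assms in \<open>auto intro: carrier_matI\<close>)

lemma transpose_mult_dims: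
  fixes A B :: "real mat"
  assumes "dim_col A = dim_row B"
  shows "transpose_mat (A * B) = transpose_mat B * transpose_mat A"
  by (rule transpose_mult[of A "dim_row A" "dim_row B" B "dim_col B"])
    (use assms in \<open>auto intro: carrier_matI\<close>)

lemma one_mult_dims [simp]:
  fixes A :: "real mat"
  shows "dim_row A = r \<Longrightarrow> 1\<^sub>m r * A = A" "dim_col A = r \<Longrightarrow> A * 1\<^sub>m r = A"
  by (metis carrier_matI left_mult_one_mat) (metis carrier_matI right_mult_one_mat)

lemma add_mult_dims:
  fixes P Q R :: "real mat"
  assumes "dim_row P = dim_row Q" "dim_col P = dim_col Q"
  shows "dim_col P = dim_row R \<Longrightarrow> (P + Q) * R = P * R + Q * R"
    and "dim_col R = dim_row P \<Longrightarrow> R * (P + Q) = R * P + R * Q"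
  using assms by (auto intro!: eq_matI simp: mult_mat_entry sum.distrib algebra_simps simp del: index_mult_mat(1))

lemma mult_smult_dims:
  fixes P Q :: "real mat"
  assumes "dim_col P = dim_row Q"
  shows "P * (c \<cdot>\<^sub>m Q) = c \<cdot>\<^sub>m (P * Q)" "c \<cdot>\<^sub>m P * Q = c \<cdot>\<^sub>m (P * Q)"
  using assms by (auto intro!: eq_matI simp: mult_mat_entry sum_distrib_left mult_ac simp del: index_mult_mat(1))

lemma frob_commute:
  assumes "dim_row X = dim_row Y" "dim_col X = dim_col Y"
  shows "frob X Y = frob Y X"
  using assms by (simp add: frob_def mult.commute)

lemma frob_add_left:
  assumes "dim_row X = dim_row Y" "dim_col X = dim_col Y"
  shows "frob (X + Y) Z = frob X Z + frob Y Z"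
  using assms by (simp add: frob_def sum.distrib distrib_right)

lemma frob_add_right:
  assumes "dim_row X = dim_row Z" "dim_col X = dim_col Z"
  shows "frob X (Y + Z) = frob X Y + frob X Z"
  using assms by (simp add: frob_def sum.distrib distrib_left)

lemma frob_smult_left: "frob (c \<cdot>\<^sub>m X) Y = c * frob X Y"
  by (simp add: frob_def sum_distrib_left mult.assoc)

lemma frob_smult_right:
  assumes "dim_row X = dim_row Y" "dim_col X = dim_col Y"
  shows "frob X (c \<cdot>\<^sub>m Y) = c * frob X Y"
  using assms by (simp add: frob_def sum_distrib_left mult_ac)

lemma frob_mult_left_adjoint:
  assumes "dim_col P = dim_row Y" "dim_row P = dim_row X" "dim_col Y = dim_col X"
  shows "frob X (P * Y) = frob (transpose_mat P * X) Y"
proof -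
  have "frob X (P * Y)
      = (\<Sum>i<dim_row X. \<Sum>j<dim_col X. \<Sum>l<dim_row Y. X $$ (i, j) * (P $$ (i, l) * Y $$ (l, j)))"
    using assms by (simp add: frob_def mult_mat_entry sum_distrib_left del: index_mult_mat(1))
  also have "\<dots> = (\<Sum>i<dim_row X. \<Sum>l<dim_row Y. \<Sum>j<dim_col X. X $$ (i, j) * (P $$ (i, l) * Y $$ (l, j)))"
    by (rule sum.cong[OF refl], rule sum.swap)
  also have "\<dots> = (\<Sum>l<dim_row Y. \<Sum>i<dim_row X. \<Sum>j<dim_col X. X $$ (i, j) * (P $$ (i, l) * Y $$ (l, j)))"
    by (rule sum.swap)
  also have "\<dots> = (\<Sum>l<dim_row Y. \<Sum>j<dim_col X. \<Sum>i<dim_row X. X $$ (i, j) * (P $$ (i, l) * Y $$ (l, j)))"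
    by (rule sum.cong[OF refl], rule sum.swap)
  also have "\<dots> = frob (transpose_mat P * X) Y"
    using assms by (simp add: frob_def mult_mat_entry sum_distrib_left sum_distrib_right mult_ac del: index_mult_mat(1))
  finally show ?thesis .
qed

lemma frob_transpose:
  assumes "dim_row X = dim_row Y" "dim_col X = dim_col Y"
  shows "frob (transpose_mat X) (transpose_mat Y) = frob X Y"
  using assms by (simp add: frob_def) (rule sum.swap)

lemma frob_mult_right_adjoint:
  assumes "dim_col Y = dim_row P" "dim_col P = dim_col X" "dim_row Y = dim_row X"
  shows "frob X (Y * P) = frob (X * transpose_mat P) Y"
proof -
  have "frob X (Y * P) = frob (transpose_mat X) (transpose_mat P * transpose_mat Y)"
    using assms by (subst frob_transpose[symmetric]) (auto simp: transpose_mult_dims)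
  also have "\<dots> = frob (transpose_mat (X * transpose_mat P)) (transpose_mat Y)"
    using assms by (subst frob_mult_left_adjoint) (auto simp: transpose_mult_dims)
  also have "\<dots> = frob (X * transpose_mat P) Y"
    using assms by (subst frob_transpose) auto
  finally show ?thesis .
qed

lemma trace_mat_eq_frob_one: "dim_row A = dim_col A \<Longrightarrow> trace_mat A = frob (1\<^sub>m (dim_col A)) A"
proof -
  assume "dim_row A = dim_col A"
  moreover have "(\<Sum>j<dim_col A. (if i = j then 1 else 0) * A $$ (i, j)) = A $$ (i, i)"
    if "i < dim_col A" for i
    using that by (subst sum.remove[of _ i]) auto
  ultimately show ?thesis
    by (simp add: trace_mat_def diag_mat_def frob_def interv_sum_list_conv_sum_set_nat
        atLeast0LessThan)
qed

lemma trace_mat_mult_transpose: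
  assumes "dim_row C = dim_row Z" "dim_col C = dim_col Z"
  shows "trace_mat (C * transpose_mat Z) = frob C Z"
  using assms
  by (simp add: trace_mat_eq_frob_one frob_mult_right_adjoint frob_commute)

lemma sum_pairs_as_stack:
  fixes f :: "nat \<Rightarrow> nat \<Rightarrow> real"
  shows "(\<Sum>p<b * a. f (p mod b) (p div b)) = (\<Sum>j<a. \<Sum>i<b. f i j)"
proof (cases "b = 0")
  case False
  show ?thesis
  proof (induction a)
    case (Suc a)
    have "(\<Sum>p<b * Suc a. f (p mod b) (p div b)) =
      (\<Sum>p<b * a. f (p mod b) (p div b)) + (\<Sum>p\<in>{b*a..<b*a+b}. f (p mod b) (p div b))"
      using sum.atLeastLessThan_concat[of 0 "b * a" "b * a + b" "\<lambda>p. f (p mod b) (p div b)"]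
      by (simp add: atLeast0LessThan add.commute)
    also have "(\<Sum>p\<in>{b*a..<b*a+b}. f (p mod b) (p div b)) = (\<Sum>i<b. f i a)"
      using sum.shift_bounds_nat_ivl[of "\<lambda>p. f (p mod b) (p div b)" 0 "b*a" b]
      using False by (simp add: atLeast0LessThan add.commute)
    finally show ?case using Suc by simp
  qed simp
qed simp

lemma dim_kron [simp]:
  "dim_row (A \<otimes>\<^sub>m D) = dim_row A * dim_row D" "dim_col (A \<otimes>\<^sub>m D) = dim_col A * dim_col D"
  by (auto simp: kron_def)

lemma dim_vec_stack [simp]: "dim_vec (vec_stack X) = dim_row X * dim_col X"
  by (simp add: vec_stack_def)

lemma mod_div_less:
  fixes p :: nat
  assumes "p < b * a"
  shows "p mod b < b" "p div b < a"
  using assms by (cases "b = 0"; simp add: less_mult_imp_div_less mult.commute)+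

lemma quad_form_eq_sum:
  assumes "dim_vec x = dim_row Q" "dim_col Q = dim_row Q"
  shows "quad_form Q x = (\<Sum>p<dim_row Q. \<Sum>q<dim_row Q. x $ p * (Q $$ (p, q) * x $ q))"
  using assms
  by (simp add: quad_form_def scalar_prod_def atLeast0LessThan sum_distrib_left)

text \<open>The identity \<open>(A \<otimes> D) vec X = vec (D X A\<^sup>T)\<close>, read as a quadratic form.\<close>

lemma quad_form_kron:
  assumes "A \<in> carrier_mat a a" "D \<in> carrier_mat b b" "X \<in> carrier_mat b a"
  shows "quad_form (A \<otimes>\<^sub>m D) (vec_stack X) = frob X (D * X * transpose_mat A)"
proof -
  have d [simp]: "dim_row A = a" "dim_col A = a" "dim_row D = b" "dim_col D = b"
    "dim_row X = b" "dim_col X = a"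
    using assms by auto
  have "quad_form (A \<otimes>\<^sub>m D) (vec_stack X)
      = (\<Sum>p<b*a. \<Sum>q<b*a. X $$ (p mod b, p div b) *
           (A $$ (p div b, q div b) * D $$ (p mod b, q mod b) * X $$ (q mod b, q div b)))"
    by (subst quad_form_eq_sum) (auto simp: kron_def vec_stack_def mult.commute[of a b] intro!: sum.cong)
  also have "\<dots> = (\<Sum>p<b*a. \<Sum>q1<a. \<Sum>q2<b. X $$ (p mod b, p div b) *
           (A $$ (p div b, q1) * D $$ (p mod b, q2) * X $$ (q2, q1)))"
    by (intro sum.cong refl sum_pairs_as_stack[where f = "\<lambda>i j. X $$ (_ mod b, _ div b) *
           (A $$ (_ div b, j) * D $$ (_ mod b, i) * X $$ (i, j))"])
  also have "\<dots> = (\<Sum>j<a. \<Sum>i<b. \<Sum>q1<a. \<Sum>q2<b. X $$ (i, j) *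
           (A $$ (j, q1) * D $$ (i, q2) * X $$ (q2, q1)))"
    by (rule sum_pairs_as_stack[where f = "\<lambda>i j. \<Sum>q1<a. \<Sum>q2<b. X $$ (i, j) *
           (A $$ (j, q1) * D $$ (i, q2) * X $$ (q2, q1))"])
  also have "\<dots> = (\<Sum>i<b. \<Sum>j<a. X $$ (i, j) * (\<Sum>q1<a. (\<Sum>q2<b. D $$ (i, q2) * X $$ (q2, q1)) * A $$ (j, q1)))"
    by (subst sum.swap) (simp add: sum_distrib_left sum_distrib_right mult_ac)
  also have "\<dots> = frob X (D * X * transpose_mat A)"
    by (simp add: frob_def mult_mat_entry del: index_mult_mat(1))
  finally show ?thesis .
qed

lemma quad_form_diff:
  assumes "dim_vec x = dim_row P" "dim_col P = dim_row P" "dim_row R = dim_row P" "dim_col R = dim_row P"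
  shows "quad_form (P - R) x = quad_form P x - quad_form R x"
  using assms by (simp add: quad_form_eq_sum algebra_simps sum_subtractf)

lemma transpose_kron: "transpose_mat (A \<otimes>\<^sub>m D) = transpose_mat A \<otimes>\<^sub>m transpose_mat D"
proof (rule eq_matI)
  fix i j assume "i < dim_row (transpose_mat A \<otimes>\<^sub>m transpose_mat D)"
    "j < dim_col (transpose_mat A \<otimes>\<^sub>m transpose_mat D)"
  then have "i < dim_col D * dim_col A" "j < dim_row D * dim_row A"
    by (auto simp: mult.commute)
  with mod_div_less[OF this(1)] mod_div_less[OF this(2)]
  show "transpose_mat (A \<otimes>\<^sub>m D) $$ (i, j) = (transpose_mat A \<otimes>\<^sub>m transpose_mat D) $$ (i, j)"
    by (simp add: kron_def mult.commute)
qed auto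

lemma vec_stack_surj:
  assumes "x \<in> carrier_vec (b * a)"
  obtains Z where "Z \<in> carrier_mat b a" "x = vec_stack Z"
proof
  show "mat b a (\<lambda>(i, j). x $ (j * b + i)) \<in> carrier_mat b a" by simp
  show "x = vec_stack (mat b a (\<lambda>(i, j). x $ (j * b + i)))"
    using assms by (intro eq_vecI) (auto simp: vec_stack_def mod_div_less)
qed

lemma dim_diag_of_vec [simp]:
  "dim_row (diag_of_vec v) = dim_vec v" "dim_col (diag_of_vec v) = dim_vec v"
  by (auto simp: diag_of_vec_def mat_diag_def)

lemma diag_of_vec_entry [simp]:
  "i < dim_vec v \<Longrightarrow> j < dim_vec v \<Longrightarrow> diag_of_vec v $$ (i, j) = (if i = j then v $ i else 0)"
  by (auto simp: diag_of_vec_def mat_diag_def)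

lemma transpose_diag_of_vec [simp]: "transpose_mat (diag_of_vec v) = diag_of_vec v"
  by (rule eq_matI) auto

lemma diag_of_vec_mult_entry:
  assumes "i < dim_vec v" "j < dim_col Y" "dim_row Y = dim_vec v"
  shows "(diag_of_vec v * Y) $$ (i, j) = v $ i * Y $$ (i, j)"
proof -
  have "(diag_of_vec v * Y) $$ (i, j) = (\<Sum>l<dim_vec v. (if i = l then v $ i else 0) * Y $$ (l, j))"
    using assms by (subst mult_mat_entry) auto
  also have "\<dots> = v $ i * Y $$ (i, j)"
    using assms by (subst sum.remove[of _ i]) auto
  finally show ?thesis .
qed

lemma mult_diag_of_vec_entry:
  assumes "j < dim_vec v" "i < dim_row Y" "dim_col Y = dim_vec v"
  shows "(Y * diag_of_vec v) $$ (i, j) = Y $$ (i, j) * v $ j"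
proof -
  have "(Y * diag_of_vec v) $$ (i, j) = (\<Sum>l<dim_vec v. Y $$ (i, l) * (if l = j then v $ l else 0))"
    using assms by (subst mult_mat_entry) auto
  also have "\<dots> = Y $$ (i, j) * v $ j"
    using assms by (subst sum.remove[of _ j]) auto
  finally show ?thesis .
qed

lemma inv_mat_eqI:
  assumes "A \<in> carrier_mat r r" "C \<in> carrier_mat r r" "A * C = 1\<^sub>m r" "C * A = 1\<^sub>m r"
  shows "inv_mat A = C"
proof (cases "mat_inverse A")
  case None
  then have "A \<notin> Units (ring_mat TYPE(real) r ())"
    by (rule mat_inverse(1)[OF assms(1)])
  with assms show ?thesis by (auto simp: Units_def ring_mat_def)
next
  case (Some D)
  then have D: "A * D = 1\<^sub>m r" "D * A = 1\<^sub>m r" "D \<in> carrier_mat r r"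
    using mat_inverse(2)[OF assms(1)] by auto
  have "D = D * (A * C)" using D assms by simp
  also have "\<dots> = (D * A) * C"
    using D(3) assms(1,2) by (simp add: mult_assoc_dims)
  also have "\<dots> = C" using D assms by simp
  finally show ?thesis using Some by (simp add: inv_mat_def)
qed

section \<open>The coordinate maps of the affine set\<close>

lemma one_smult [simp]: "(1 :: real) \<cdot>\<^sub>m A = A"
  by (rule eq_matI) auto

lemma dim_outer_prod [simp]:
  "dim_row (outer_prod u v) = dim_vec u" "dim_col (outer_prod u v) = dim_vec v"
  by (auto simp: outer_prod_def)

lemma outer_prod_entry [simp]:
  "i < dim_vec u \<Longrightarrow> j < dim_vec v \<Longrightarrow> outer_prod u v $$ (i, j) = u $ i * v $ j"
  by (auto simp: outer_prod_def)

lemma mult_outer_prod: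
  assumes "dim_col D = dim_vec u"
  shows "D * outer_prod u v = outer_prod (D *\<^sub>v u) v"
  using assms
  by (intro eq_matI) (auto simp: mult_mat_entry scalar_prod_def sum_distrib_left sum_distrib_right atLeast0LessThan mult_ac)

lemma outer_prod_mult:
  assumes "dim_row D = dim_vec v"
  shows "outer_prod u v * D = outer_prod u (transpose_mat D *\<^sub>v v)"
  using assms
  by (intro eq_matI) (auto simp: mult_mat_entry scalar_prod_def sum_distrib_left atLeast0LessThan mult_ac)

lemma outer_prod_zero [simp]:
  "outer_prod (0\<^sub>v r) v = 0\<^sub>m r (dim_vec v)" "outer_prod u (0\<^sub>v r) = 0\<^sub>m (dim_vec u) r"
  by (auto intro!: eq_matI)

text \<open>A square matrix with orthonormal columns has orthonormal rows too; the first two claims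
  read off the column relations, the last one the row relations.\<close>

lemma orthogonal_prepend_col:
  assumes V: "V \<in> carrier_mat n (n - 1)" and v: "v \<in> carrier_vec n" and n: "n > 0"
    and orth: "orthogonal_matrix (prepend_col v V)"
  shows "transpose_mat V * V = 1\<^sub>m (n - 1)"
    and "transpose_mat V *\<^sub>v v = 0\<^sub>v (n - 1)"
    and "V * transpose_mat V = 1\<^sub>m n - outer_prod v v"
proof -
  define Q where "Q = prepend_col v V"
  have dim: "dim_row V = n" "dim_col V = n - 1" "dim_vec v = n"
    using V v by auto
  have Qc: "Q \<in> carrier_mat n n"
    using V v n by (auto simp: Q_def prepend_col_def)
  have Q0: "Q $$ (i, 0) = v $ i" if "i < n" for i
    using that V v n by (simp add: Q_def prepend_col_def mat_of_cols_index)
  have QS: "Q $$ (i, Suc j) = V $$ (i, j)" if "i < n" "j < n - 1" for i j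
    using that V v n by (simp add: Q_def prepend_col_def mat_of_cols_index)
  have QtQ: "transpose_mat Q * Q = 1\<^sub>m n"
    using orth Qc by (simp add: orthogonal_matrix_def Q_def[symmetric])
  then have QQt: "Q * transpose_mat Q = 1\<^sub>m n"
    using mat_mult_left_right_inverse[of "transpose_mat Q" n Q] Qc by simp
  have cols: "(\<Sum>l<n. Q $$ (l, i) * Q $$ (l, j)) = (if i = j then 1 else 0)" if "i < n" "j < n" for i j
    using arg_cong[OF QtQ, of "\<lambda>A. A $$ (i, j)"] that Qc
    by (simp add: mult_mat_entry del: index_mult_mat(1))
  have rows: "(\<Sum>l<n. Q $$ (i, l) * Q $$ (j, l)) = (if i = j then 1 else 0)" if "i < n" "j < n" for i j
    using arg_cong[OF QQt, of "\<lambda>A. A $$ (i, j)"] that Qc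
    by (simp add: mult_mat_entry del: index_mult_mat(1))
  show "transpose_mat V * V = 1\<^sub>m (n - 1)"
  proof (rule eq_matI)
    fix i j assume "i < dim_row (1\<^sub>m (n - 1) :: real mat)" "j < dim_col (1\<^sub>m (n - 1) :: real mat)"
    then show "(transpose_mat V * V) $$ (i, j) = 1\<^sub>m (n - 1) $$ (i, j)"
      using cols[of "Suc i" "Suc j"] dim by (simp add: mult_mat_entry QS del: index_mult_mat(1))
  qed (use dim in auto)
  show "transpose_mat V *\<^sub>v v = 0\<^sub>v (n - 1)"
  proof (rule eq_vecI)
    fix i assume "i < dim_vec (0\<^sub>v (n - 1) :: real vec)"
    then show "(transpose_mat V *\<^sub>v v) $ i = 0\<^sub>v (n - 1) $ i"
      using cols[of "Suc i" 0] dim n by (simp add: scalar_prod_def atLeast0LessThan QS Q0)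
  qed (use dim in auto)
  show "V * transpose_mat V = 1\<^sub>m n - outer_prod v v"
  proof (rule eq_matI)
    fix i j assume "i < dim_row (1\<^sub>m n - outer_prod v v)" "j < dim_col (1\<^sub>m n - outer_prod v v)"
    then have ij: "i < n" "j < n" using dim by auto
    have "(\<Sum>l<Suc (n - 1). Q $$ (i, l) * Q $$ (j, l)) = v $ i * v $ j + (\<Sum>l<n - 1. V $$ (i, l) * V $$ (j, l))"
      using ij by (subst sum.lessThan_Suc_shift) (simp add: Q0 QS)
    then show "(V * transpose_mat V) $$ (i, j) = (1\<^sub>m n - outer_prod v v) $$ (i, j)"
      using rows[of i j] ij n dim by (simp add: mult_mat_entry del: index_mult_mat(1))
  qed (use dim in auto)
qed

lemma dim_ones_vec [simp]: "dim_vec (ones_vec r) = r"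
  by (simp add: ones_vec_def)

lemma ones_vec_entry [simp]: "i < r \<Longrightarrow> ones_vec r $ i = 1"
  by (simp add: ones_vec_def)

lemma Bmat_carrier [simp]: "k > 0 \<Longrightarrow> Bmat k \<in> carrier_mat k k"
  by (auto simp: Bmat_def)

lemma Bmat_entry:
  assumes "i < k" "j < k"
  shows "Bmat k $$ (i, j) = (if i \<noteq> j \<and> i < k - 1 \<and> j < k - 1 then 1 else 0)"
  using assms by (auto simp: Bmat_def)

lemma Bmat_symmetric: "k > 0 \<Longrightarrow> transpose_mat (Bmat k) = Bmat k"
proof -
  assume "k > 0"
  then have "dim_row (Bmat k) = k" "dim_col (Bmat k) = k"
    using Bmat_carrier[of k] by (auto simp del: Bmat_carrier)
  then show ?thesis by (intro eq_matI) (auto simp: Bmat_entry)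
qed

locale partition_bases =
  fixes n k :: nat and m :: "nat vec" and V W :: "real mat"
  assumes k_pos: "k > 0"
    and m_carrier: "m \<in> carrier_vec k" and m_pos: "\<And>i. i < k \<Longrightarrow> m $ i > 0"
    and m_sum: "(\<Sum>i<k. m $ i) = n"
    and V_carrier: "V \<in> carrier_mat n (n - 1)"
    and V_orth: "orthogonal_matrix (prepend_col ((1 / sqrt (real n)) \<cdot>\<^sub>v ones_vec n) V)"
    and W_carrier: "W \<in> carrier_mat k (k - 1)"
    and W_orth: "orthogonal_matrix (prepend_col ((1 / sqrt (real n)) \<cdot>\<^sub>v sqrt_vec m) W)"
begin

abbreviation "B \<equiv> Bmat k"
abbreviation "Mt \<equiv> Mtilde m"
abbreviation "Vt \<equiv> transpose_mat V"
abbreviation "Wt \<equiv> transpose_mat W"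

definition Mt_inv :: "real mat" where
  "Mt_inv = diag_of_vec (map_vec inverse (sqrt_vec m))"

lemma n_pos: "n > 0"
  using m_sum m_pos[of 0] k_pos by (metis bot_nat_0.not_eq_extremum finite_lessThan lessThan_iff less_numeral_extra(3) sum_eq_0_iff)

lemma dims [simp]:
  "dim_vec m = k" "dim_vec (sqrt_vec m) = k" "dim_vec (real_vec m) = k"
  "dim_row V = n" "dim_col V = n - 1" "dim_row W = k" "dim_col W = k - 1"
  "dim_row B = k" "dim_col B = k" "dim_row Mt = k" "dim_col Mt = k" "dim_row Mt_inv = k" "dim_col Mt_inv = k"
  "dim_row (Xhat n m) = n" "dim_col (Xhat n m) = k"
  using m_carrier V_carrier W_carrier Bmat_carrier[OF k_pos]
  by (auto simp: sqrt_vec_def real_vec_def Mtilde_def Mt_inv_def Xhat_def simp del: Bmat_carrier)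

lemma Mt_inv_symmetric [simp]: "transpose_mat Mt_inv = Mt_inv" and Mt_symmetric [simp]: "transpose_mat Mt = Mt"
  by (auto simp: Mt_inv_def Mtilde_def)

lemma sqrt_vec_entry [simp]: "i < k \<Longrightarrow> sqrt_vec m $ i = sqrt (m $ i)"
  and real_vec_entry [simp]: "i < k \<Longrightarrow> real_vec m $ i = m $ i"
  using m_carrier by (auto simp: sqrt_vec_def real_vec_def)

lemma Mt_Mt_inv: "Mt * Mt_inv = 1\<^sub>m k" and Mt_inv_Mt: "Mt_inv * Mt = 1\<^sub>m k"
  using m_pos by (auto intro!: eq_matI simp: Mtilde_def Mt_inv_def diag_of_vec_mult_entry simp del: index_mult_mat(1))

lemma inv_mat_Mtilde: "inv_mat Mt = Mt_inv"
  by (rule inv_mat_eqI[of _ k]) (auto intro!: carrier_matI simp: Mt_Mt_inv Mt_inv_Mt)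

lemma Mmat_eq: "Mmat m = Mt * Mt"
  by (auto intro!: eq_matI simp: Mtilde_def Mmat_def diag_of_vec_mult_entry simp del: index_mult_mat(1))

lemma inv_mat_Mmat: "inv_mat (Mmat m) = Mt_inv * Mt_inv"
proof -
  have "Mt * Mt * (Mt_inv * Mt_inv) = Mt * (Mt * Mt_inv) * Mt_inv" "Mt_inv * Mt_inv * (Mt * Mt) = Mt_inv * (Mt_inv * Mt) * Mt"
    by (simp_all add: mult_assoc_dims)
  then show ?thesis unfolding Mmat_eq
    by (intro inv_mat_eqI[of _ k]) (auto intro!: carrier_matI simp: Mt_Mt_inv Mt_inv_Mt)
qed

lemma Wt_sqrt_zero: "Wt *\<^sub>v sqrt_vec m = 0\<^sub>v (k - 1)"
  and Vt_ones_zero: "Vt *\<^sub>v ones_vec n = 0\<^sub>v (n - 1)"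
  and VtV: "Vt * V = 1\<^sub>m (n - 1)" and WtW: "Wt * W = 1\<^sub>m (k - 1)"
  and VVt: "V * Vt = 1\<^sub>m n - (1 / real n) \<cdot>\<^sub>m outer_prod (ones_vec n) (ones_vec n)"
  and WWt: "W * Wt = 1\<^sub>m k - (1 / real n) \<cdot>\<^sub>m outer_prod (sqrt_vec m) (sqrt_vec m)"
proof -
  have c: "sqrt_vec m \<in> carrier_vec k" "ones_vec n \<in> carrier_vec n"
    by (auto intro: carrier_vecI)
  let ?c = "1 / sqrt (real n)"
  have o: "outer_prod (?c \<cdot>\<^sub>v u) (?c \<cdot>\<^sub>v u) = (1 / real n) \<cdot>\<^sub>m outer_prod u u" for u
    by (rule eq_matI) (auto simp: n_pos)
  have z: "A *\<^sub>v u = 0\<^sub>v r" if "A *\<^sub>v (?c \<cdot>\<^sub>v u) = 0\<^sub>v r" "u \<in> carrier_vec l" "A \<in> carrier_mat r l" for A u l r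
  proof -
    have "A *\<^sub>v u = sqrt (real n) \<cdot>\<^sub>v (?c \<cdot>\<^sub>v (A *\<^sub>v u))"
      using n_pos by (simp add: smult_smult_assoc)
    also have "?c \<cdot>\<^sub>v (A *\<^sub>v u) = A *\<^sub>v (?c \<cdot>\<^sub>v u)"
      by (rule mult_mat_vec[OF that(3,2), symmetric])
    also note that(1)
    finally show ?thesis by auto
  qed
  note v = orthogonal_prepend_col[OF V_carrier _ n_pos V_orth]
  note w = orthogonal_prepend_col[OF W_carrier _ k_pos W_orth]
  show "Vt * V = 1\<^sub>m (n - 1)" "Wt * W = 1\<^sub>m (k - 1)" using v(1) w(1) c by auto
  show "V * Vt = 1\<^sub>m n - (1 / real n) \<cdot>\<^sub>m outer_prod (ones_vec n) (ones_vec n)"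
    "W * Wt = 1\<^sub>m k - (1 / real n) \<cdot>\<^sub>m outer_prod (sqrt_vec m) (sqrt_vec m)"
    using v(3) w(3) c by (auto simp: o)
  show "Wt *\<^sub>v sqrt_vec m = 0\<^sub>v (k - 1)" "Vt *\<^sub>v ones_vec n = 0\<^sub>v (n - 1)"
    using z[OF w(2) c(1)] z[OF v(2) c(2)] c V_carrier W_carrier by auto
qed

lemma Mt_ones: "Mt *\<^sub>v ones_vec k = sqrt_vec m"
proof (rule eq_vecI)
  fix i assume "i < dim_vec (sqrt_vec m)"
  then have i: "i < k" by simp
  have "(\<Sum>l<k. (if i = l then sqrt (m $ i) else 0)) = sqrt (m $ i)"
    using i by simp
  with i show "(Mt *\<^sub>v ones_vec k) $ i = sqrt_vec m $ i"
    by (simp add: Mtilde_def scalar_prod_def atLeast0LessThan)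
qed simp

lemma Mt_inv_sqrt: "Mt_inv *\<^sub>v sqrt_vec m = ones_vec k"
proof -
  have "Mt_inv *\<^sub>v (Mt *\<^sub>v ones_vec k) = (Mt_inv * Mt) *\<^sub>v ones_vec k"
    by (rule assoc_mult_mat_vec[symmetric, of _ k k _ k]) (auto intro: carrier_matI carrier_vecI)
  then show ?thesis
    by (simp add: Mt_ones Mt_inv_Mt) (metis carrier_vecI dim_ones_vec one_mult_mat_vec)
qed

lemma Mt_sqrt: "Mt *\<^sub>v sqrt_vec m = real_vec m"
proof (rule eq_vecI)
  fix i assume "i < dim_vec (real_vec m)"
  then have i: "i < k" by simp
  have "(\<Sum>l<k. (if i = l then sqrt_vec m $ i else 0) * sqrt (m $ l)) = real (m $ i)"
    using i by (subst sum.remove[of _ i]) auto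
  with i show "(Mt *\<^sub>v sqrt_vec m) $ i = real_vec m $ i"
    by (simp add: Mtilde_def scalar_prod_def atLeast0LessThan)
qed simp

lemma Mt_inv_real: "Mt_inv *\<^sub>v real_vec m = sqrt_vec m"
proof -
  have "Mt_inv *\<^sub>v (Mt *\<^sub>v sqrt_vec m) = (Mt_inv * Mt) *\<^sub>v sqrt_vec m"
    by (rule assoc_mult_mat_vec[symmetric, of _ k k _ k]) (auto intro: carrier_matI carrier_vecI)
  then show ?thesis
    by (simp add: Mt_sqrt Mt_inv_Mt) (metis carrier_vecI dims(2) one_mult_mat_vec)
qed

lemma Vt_Xhat: "Vt * Xhat n m = 0\<^sub>m (n - 1) k"
  by (auto simp: Xhat_def mult_smult_dims mult_outer_prod Vt_ones_zero intro!: eq_matI simp del: index_mult_mat(1))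

lemma Xhat_Mt_inv_W: "Xhat n m * Mt_inv * W = 0\<^sub>m n (k - 1)"
  by (auto simp: Xhat_def mult_smult_dims outer_prod_mult Mt_inv_real Wt_sqrt_zero intro!: eq_matI simp del: index_mult_mat(1))

text \<open>Of the projections \<open>V V\<^sup>T = 1 - \<one>\<one>\<^sup>T / n\<close> and \<open>W W\<^sup>T = 1 - (\<mu>\<one>)(\<mu>\<one>)\<^sup>T / n\<close>, the first fixes \<open>D\<close>
  because \<open>\<one>\<^sup>T D = 0\<close>, and the second fixes \<open>D \<mu>\<^sup>-\<^sup>1\<close> because \<open>D \<mu>\<^sup>-\<^sup>1 \<mu>\<one> = D \<one> = 0\<close>.\<close>

lemma tangent_decomposition:
  assumes "D \<in> tangent_space n k"
  shows "D = V * (Vt * D * Mt_inv * W) * Wt * Mt"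
proof -
  have d [simp]: "dim_row D = n" "dim_col D = k"
    and D: "D *\<^sub>v ones_vec k = 0\<^sub>v n" "transpose_mat D *\<^sub>v ones_vec n = 0\<^sub>v k"
    using assms by (auto simp: tangent_space_def)
  have left: "V * Vt * D = D"
  proof -
    have "V * Vt * D = D - (1 / real n) \<cdot>\<^sub>m outer_prod (ones_vec n) (ones_vec n) * D"
      unfolding VVt by (subst minus_mult_distrib_mat[of _ n n _ _ k]) (auto intro: carrier_matI)
    also have "\<dots> = D" by (auto simp: mult_smult_dims outer_prod_mult D intro!: eq_matI simp del: index_mult_mat(1))
    finally show ?thesis .
  qed
  have right: "D * Mt_inv * (W * Wt) = D * Mt_inv"
  proof -
    have "(D * Mt_inv) *\<^sub>v sqrt_vec m = D *\<^sub>v (Mt_inv *\<^sub>v sqrt_vec m)"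
      by (rule assoc_mult_mat_vec[of _ n k _ k]) (auto intro: carrier_matI carrier_vecI)
    then have z: "(D * Mt_inv) *\<^sub>v sqrt_vec m = 0\<^sub>v n" by (simp add: Mt_inv_sqrt D)
    have "D * Mt_inv * (W * Wt) = D * Mt_inv - D * Mt_inv * ((1 / real n) \<cdot>\<^sub>m outer_prod (sqrt_vec m) (sqrt_vec m))"
      unfolding WWt by (subst mult_minus_distrib_mat[of _ n k _ k]) (auto intro: carrier_matI)
    also have "\<dots> = D * Mt_inv"
      by (auto simp: mult_smult_dims mult_outer_prod z intro!: eq_matI simp del: index_mult_mat(1))
    finally show ?thesis .
  qed
  have "V * (Vt * D * Mt_inv * W) * Wt * Mt = (V * Vt * D) * Mt_inv * (W * Wt) * Mt"
    by (simp add: mult_assoc_dims)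
  also have "\<dots> = D * (Mt_inv * Mt)"
    unfolding left right by (simp add: mult_assoc_dims)
  also have "\<dots> = D" by (simp add: Mt_inv_Mt)
  finally show ?thesis by simp
qed

text \<open>The coefficient \<open>c\<close> of the centre is \<open>1\<close> for points of the affine set and \<open>0\<close> for tangent
  directions.\<close>

definition embed :: "real \<Rightarrow> real mat \<Rightarrow> real mat" where
  "embed c Z = c \<cdot>\<^sub>m Xhat n m + V * Z * Wt * Mt"

lemma dim_embed [simp]: "dim_row (embed c Z) = n" "dim_col (embed c Z) = k"
  by (auto simp: embed_def)

lemma Vt_embed_Mt_inv:
  assumes "Z \<in> carrier_mat (n - 1) (k - 1)"
  shows "Vt * embed c Z * Mt_inv = Z * Wt"
proof -
  have d [simp]: "dim_row Z = n - 1" "dim_col Z = k - 1" using assms by auto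
  have "Vt * embed c Z * Mt_inv = c \<cdot>\<^sub>m (Vt * Xhat n m) * Mt_inv + (Vt * V) * Z * Wt * (Mt * Mt_inv)"
    unfolding embed_def by (simp add: add_mult_dims mult_assoc_dims mult_smult_dims)
  also have "\<dots> = Z * Wt"
    by (auto simp: Vt_Xhat VtV Mt_Mt_inv mult_assoc_dims mult_smult_dims intro!: eq_matI)
  finally show ?thesis .
qed

lemma embed_Mt_inv_W:
  assumes "Z \<in> carrier_mat (n - 1) (k - 1)"
  shows "embed c Z * Mt_inv * W = V * Z"
proof -
  have d [simp]: "dim_row Z = n - 1" "dim_col Z = k - 1" using assms by auto
  have "embed c Z * Mt_inv * W = c \<cdot>\<^sub>m (Xhat n m * Mt_inv * W) + V * Z * (Wt * (Mt * Mt_inv) * W)"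
    unfolding embed_def by (simp add: add_mult_dims mult_assoc_dims mult_smult_dims)
  also have "\<dots> = V * Z"
    by (auto simp: Xhat_Mt_inv_W WtW Mt_Mt_inv intro!: eq_matI)
  finally show ?thesis .
qed

lemma embed_in_affine_set:
  assumes "Z \<in> carrier_mat (n - 1) (k - 1)"
  shows "embed 1 Z \<in> affine_set n m"
proof -
  have d [simp]: "dim_row Z = n - 1" "dim_col Z = k - 1" using assms by auto
  have a: "(V * Z * Wt * Mt) *\<^sub>v ones_vec k = 0\<^sub>v n"
  proof -
    have "(V * Z * Wt * Mt) *\<^sub>v ones_vec k = (V * Z) *\<^sub>v (Wt *\<^sub>v (Mt *\<^sub>v ones_vec k))"
      by (subst assoc_mult_mat_vec[of _ n k _ k], auto intro!: carrier_matI carrier_vecI)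
        (subst assoc_mult_mat_vec[of _ n "k - 1" _ k], auto intro!: carrier_matI carrier_vecI)
    then show ?thesis by (auto simp: Mt_ones Wt_sqrt_zero scalar_prod_def intro!: eq_vecI)
  qed
  have b: "transpose_mat (V * Z * Wt * Mt) *\<^sub>v ones_vec n = 0\<^sub>v k"
  proof -
    have "transpose_mat (V * Z * Wt * Mt) = Mt * W * transpose_mat Z * Vt"
      by (simp add: transpose_mult_dims mult_assoc_dims)
    also have "\<dots> *\<^sub>v ones_vec n = (Mt * W * transpose_mat Z) *\<^sub>v (Vt *\<^sub>v ones_vec n)"
      by (subst assoc_mult_mat_vec[of _ k "n - 1" _ n]) (auto intro!: carrier_matI carrier_vecI)
    finally show ?thesis by (auto simp: Vt_ones_zero scalar_prod_def intro!: eq_vecI)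
  qed
  have "embed 1 Z *\<^sub>v ones_vec k = Xhat n m *\<^sub>v ones_vec k + (V * Z * Wt * Mt) *\<^sub>v ones_vec k"
    by (simp add: embed_def) 
      (subst add_mult_distrib_mat_vec[of _ n k], auto intro!: carrier_matI carrier_vecI)
  also have "\<dots> = ones_vec n"
  proof -
    have "(\<Sum>j<k. real (m $ j) / real n) = 1"
      using n_pos by (simp flip: sum_divide_distrib of_nat_sum add: m_sum)
    then show ?thesis unfolding a
      by (intro eq_vecI) (auto simp: Xhat_def scalar_prod_def atLeast0LessThan)
  qed
  finally have 1: "embed 1 Z *\<^sub>v ones_vec k = ones_vec n" .
  have "transpose_mat (embed 1 Z) *\<^sub>v ones_vec n
      = transpose_mat (Xhat n m) *\<^sub>v ones_vec n + transpose_mat (V * Z * Wt * Mt) *\<^sub>v ones_vec n"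
    by (simp add: embed_def transpose_add[of _ n k] carrier_matI) 
      (subst add_mult_distrib_mat_vec[of _ k n], auto intro!: carrier_matI carrier_vecI)
  also have "\<dots> = real_vec m"
    unfolding b using n_pos by (intro eq_vecI) (auto simp: Xhat_def scalar_prod_def)
  finally have 2: "transpose_mat (embed 1 Z) *\<^sub>v ones_vec n = real_vec m" .
  show ?thesis using 1 2 by (auto simp: affine_set_def intro: carrier_matI)
qed

lemma affine_set_eq_embed:
  assumes "X \<in> affine_set n m"
  shows "X = embed 1 (Vt * X * Mt_inv * W)"
proof -
  have d [simp]: "dim_row X = n" "dim_col X = k"
    and X: "X *\<^sub>v ones_vec k = ones_vec n" "transpose_mat X *\<^sub>v ones_vec n = real_vec m"
    using assms by (auto simp: affine_set_def)
  define D where "D = X - Xhat n m"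
  have z: "Xhat n m = embed 1 (0\<^sub>m (n-1) (k-1))" 
    unfolding embed_def by (rule eq_matI) (auto simp: mult_mat_entry simp del: index_mult_mat(1))
  have zh: "Xhat n m *\<^sub>v ones_vec k = ones_vec n" "transpose_mat (Xhat n m) *\<^sub>v ones_vec n = real_vec m"
    using embed_in_affine_set[of "0\<^sub>m (n-1) (k-1)"]
    unfolding z[symmetric] by (simp_all add: affine_set_def flip: z)
  have "D *\<^sub>v ones_vec k = X *\<^sub>v ones_vec k - Xhat n m *\<^sub>v ones_vec k"
    unfolding D_def by (subst minus_mult_distrib_mat_vec[of _ n k]) (auto intro!: carrier_matI carrier_vecI)
  moreover have "transpose_mat D *\<^sub>v ones_vec n = transpose_mat X *\<^sub>v ones_vec n - transpose_mat (Xhat n m) *\<^sub>v ones_vec n"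
    unfolding D_def transpose_minus[of X n k "Xhat n m", OF carrier_matI carrier_matI, simplified]
    by (subst minus_mult_distrib_mat_vec[of _ k n]) (auto intro!: carrier_matI carrier_vecI)
  ultimately have "D \<in> tangent_space n k"
    by (auto simp: tangent_space_def X zh D_def intro!: carrier_matI eq_vecI)
  then have "D = V * (Vt * D * Mt_inv * W) * Wt * Mt" by (rule tangent_decomposition)
  moreover have "Vt * D = Vt * X"
    by (simp add: D_def mult_minus_distrib_mat[of _ "n-1" n _ k] carrier_matI Vt_Xhat)
      (auto intro!: eq_matI)
  moreover have "X = Xhat n m + D" by (auto simp: D_def intro!: eq_matI)
  ultimately show ?thesis
    by (metis embed_def one_smult)
qed

end

section \<open>The two quadratic programs in common coordinates\<close>

lemma frob_sandwich:
  assumes "dim_row P = dim_row X" "dim_col Q = dim_col X" "dim_col P = dim_row Y" "dim_row Q = dim_col Y"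
  shows "frob X (P * Y * Q) = frob (transpose_mat P * X * transpose_mat Q) Y"
  using assms
  by (subst frob_mult_right_adjoint, simp_all)
    (subst frob_mult_left_adjoint, simp_all add: mult_assoc_dims)

lemma frob_outer_prod:
  assumes "dim_vec u = dim_vec p" "dim_vec v = dim_vec q"
  shows "frob (outer_prod u v) (outer_prod p q) = (u \<bullet> p) * (v \<bullet> q)"
  using assms
  by (simp add: frob_def scalar_prod_def atLeast0LessThan sum_product mult_ac)

lemma dim_Qhat [simp]:
  "dim_row (Qhat Bh Gh S T) = dim_row T * dim_row Gh"
  "dim_col (Qhat Bh Gh S T) = dim_col T * dim_row Gh"
  by (auto simp: Qhat_def)

lemma quad_form_Qhat:
  assumes "Bh \<in> sym_mat a" "Gh \<in> sym_mat b" "S \<in> carrier_mat b b" "T \<in> sym_mat a" "Z \<in> carrier_mat b a"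
  shows "quad_form (Qhat Bh Gh S T) (vec_stack Z)
    = frob Z (Gh * Z * Bh) - frob Z (S * Z) - frob Z (Z * T)"
proof -
  have c: "Bh \<in> carrier_mat a a" "Gh \<in> carrier_mat b b" "T \<in> carrier_mat a a"
    "transpose_mat Bh = Bh" "transpose_mat T = T"
    and d [simp]: "dim_row Bh = a" "dim_col Bh = a" "dim_row Gh = b" "dim_col Gh = b" "dim_row T = a" "dim_col T = a"
    "dim_row S = b" "dim_col S = b" "dim_row Z = b" "dim_col Z = a"
    using assms by (auto simp: sym_mat_def)
  show ?thesis
    using c assms(3,5) unfolding Qhat_def
    by (simp add: quad_form_diff quad_form_kron[of _ a _ b] mult.commute[of a b])
qed

context partition_bases
begin

lemma Ghat_symmetric:
  assumes "G \<in> sym_mat n"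
  shows "Ghat V G \<in> sym_mat (n - 1)"
  using assms by (auto simp: Ghat_def sym_mat_def transpose_mult_dims mult_assoc_dims intro!: carrier_matI)

lemma Bhat_symmetric: "Bhat m W \<in> sym_mat (k - 1)"
  by (auto simp: Bhat_def sym_mat_def transpose_mult_dims mult_assoc_dims Bmat_symmetric[OF k_pos] intro!: carrier_matI)

lemma alpha_eq_frob:
  assumes "G \<in> sym_mat n"
  shows "alpha n m G = frob (Xhat n m) (G * Xhat n m * B)"
proof -
  have [simp]: "dim_row G = n" "dim_col G = n" using assms by (auto simp: sym_mat_def)
  have "G * Xhat n m * B = (1 / real n) \<cdot>\<^sub>m outer_prod (G *\<^sub>v ones_vec n) (B *\<^sub>v real_vec m)"
    by (simp add: Xhat_def mult_smult_dims mult_outer_prod outer_prod_mult Bmat_symmetric[OF k_pos])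
  then show ?thesis
    by (simp add: Xhat_def frob_smult_left frob_smult_right frob_outer_prod alpha_def quad_form_def
        power2_eq_square)
qed

lemma quad_form_Qtilde:
  assumes "G \<in> sym_mat n" "S \<in> carrier_mat (n - 1) (n - 1)" "T \<in> sym_mat (k - 1)" "X \<in> carrier_mat n k"
  shows "quad_form (Qtilde n m G V W S T) (vec_stack X)
    = frob X (G * X * B) - frob (Vt * X * Mt_inv) (S * (Vt * X * Mt_inv)) - frob (X * Mt_inv * W) (X * Mt_inv * W * T)"
proof -
  have [simp]: "dim_row G = n" "dim_col G = n" "dim_row S = n - 1" "dim_col S = n - 1"
    "dim_row T = k - 1" "dim_col T = k - 1" "dim_row X = n" "dim_col X = k"
    and Tt: "transpose_mat T = T"
    using assms by (auto simp: sym_mat_def)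
  have "quad_form (B \<otimes>\<^sub>m G) (vec_stack X) = frob X (G * X * B)"
    by (subst quad_form_kron[of _ k _ n]) (auto intro: carrier_matI simp: Bmat_symmetric[OF k_pos])
  moreover have "quad_form ((Mt_inv * Mt_inv) \<otimes>\<^sub>m (V * S * Vt)) (vec_stack X)
      = frob (Vt * X * Mt_inv) (S * (Vt * X * Mt_inv))"
  proof -
    have "quad_form ((Mt_inv * Mt_inv) \<otimes>\<^sub>m (V * S * Vt)) (vec_stack X) = frob X (V * S * Vt * X * (Mt_inv * Mt_inv))"
      by (subst quad_form_kron[of _ k _ n]) (auto intro: carrier_matI simp: transpose_mult_dims)
    also have "\<dots> = frob X (V * (S * (Vt * X * Mt_inv)) * Mt_inv)"
      by (simp add: mult_assoc_dims)
    finally show ?thesis by (simp add: frob_sandwich)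
  qed
  moreover have "quad_form ((Mt_inv * W * T * Wt * Mt_inv) \<otimes>\<^sub>m 1\<^sub>m n) (vec_stack X)
      = frob (X * Mt_inv * W) (X * Mt_inv * W * T)"
  proof -
    have "quad_form ((Mt_inv * W * T * Wt * Mt_inv) \<otimes>\<^sub>m 1\<^sub>m n) (vec_stack X) = frob X (X * (Mt_inv * W * T * Wt * Mt_inv))"
      by (subst quad_form_kron[of _ k _ n])
        (auto intro: carrier_matI simp: transpose_mult_dims mult_assoc_dims Tt)
    also have "\<dots> = frob X ((X * Mt_inv * W * T) * (Wt * Mt_inv))"
      by (simp add: mult_assoc_dims)
    finally show ?thesis
      by (subst (asm) frob_mult_right_adjoint) (auto simp: transpose_mult_dims mult_assoc_dims)
  qed
  ultimately show ?thesis
    unfolding Qtilde_def inv_mat_Mmat inv_mat_Mtilde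
    by (simp add: quad_form_diff mult.commute[of n k])
qed

lemma frob_mult_Wt:
  assumes "S \<in> carrier_mat (n - 1) (n - 1)" "Z \<in> carrier_mat (n - 1) (k - 1)"
  shows "frob (Z * Wt) (S * (Z * Wt)) = frob Z (S * Z)"
proof -
  have [simp]: "dim_row S = n - 1" "dim_col S = n - 1" "dim_row Z = n - 1" "dim_col Z = k - 1"
    using assms by auto
  have "frob (Z * Wt) (S * (Z * Wt)) = frob (Z * Wt) ((S * Z) * Wt)" by (simp add: mult_assoc_dims)
  also have "\<dots> = frob (Z * (Wt * W)) (S * Z)"
    by (subst frob_mult_right_adjoint) (auto simp: mult_assoc_dims)
  finally show ?thesis by (simp add: WtW)
qed

lemma frob_V_mult:
  assumes "T \<in> carrier_mat (k - 1) (k - 1)" "Z \<in> carrier_mat (n - 1) (k - 1)"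
  shows "frob (V * Z) (V * Z * T) = frob Z (Z * T)"
proof -
  have [simp]: "dim_row T = k - 1" "dim_col T = k - 1" "dim_row Z = n - 1" "dim_col Z = k - 1"
    using assms by auto
  have "frob (V * Z) (V * Z * T) = frob (V * Z) (V * (Z * T))" by (simp add: mult_assoc_dims)
  also have "\<dots> = frob ((Vt * V) * Z) (Z * T)"
    by (subst frob_mult_left_adjoint) (auto simp: mult_assoc_dims)
  finally show ?thesis by (simp add: VtV)
qed

text \<open>Both correction terms see \<open>X\<close> only through \<open>V\<^sup>T X \<mu>\<^sup>-\<^sup>1\<close> and \<open>X \<mu>\<^sup>-\<^sup>1 W\<close>, which annihilate the centre.
  So they do not depend on \<open>c\<close>, and one identity serves the affine set (\<open>c = 1\<close>) and
  its tangent space (\<open>c = 0\<close>).\<close>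

lemma quad_form_Qtilde_embed:
  assumes G: "G \<in> sym_mat n" and S: "S \<in> carrier_mat (n - 1) (n - 1)" and T: "T \<in> sym_mat (k - 1)"
    and Z: "Z \<in> carrier_mat (n - 1) (k - 1)"
  shows "quad_form (Qtilde n m G V W S T) (vec_stack (embed c Z))
    = c\<^sup>2 * alpha n m G + c * trace_mat (Cmat n m G V W * transpose_mat Z)
      + quad_form (Qhat (Bhat m W) (Ghat V G) S T) (vec_stack Z)"
proof -
  have [simp]: "dim_row G = n" "dim_col G = n" "dim_row S = n - 1" "dim_col S = n - 1"
    "dim_row T = k - 1" "dim_col T = k - 1" "dim_row Z = n - 1" "dim_col Z = k - 1"
    and Gt: "transpose_mat G = G"
    using G S T Z by (auto simp: sym_mat_def)
  note Bt = Bmat_symmetric[OF k_pos]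
  let ?H = "Xhat n m" and ?Y = "V * Z * (Wt * Mt)"
  have e: "embed c Z = c \<cdot>\<^sub>m ?H + ?Y" by (simp add: embed_def mult_assoc_dims)
  have cross: "frob ?H (G * ?Y * B) = frob ?Y (G * ?H * B)"
    by (simp add: frob_sandwich[of G ?H B ?Y] Gt Bt frob_commute[of ?Y])
  have "2 * frob ?Y (G * ?H * B) = trace_mat (Cmat n m G V W * transpose_mat Z)"
  proof -
    have "frob ?Y (G * ?H * B) = frob (G * ?H * B) (V * Z * (Wt * Mt))"
      by (rule frob_commute) auto
    also have "\<dots> = frob (Vt * G * ?H * B * Mt * W) Z"
      by (subst frob_sandwich) (auto simp: transpose_mult_dims mult_assoc_dims)
    finally show ?thesis
      by (subst trace_mat_mult_transpose) (auto simp: Cmat_def frob_smult_left)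
  qed
  moreover have "frob ?Y (G * ?Y * B) = frob Z (Ghat V G * Z * Bhat m W)"
  proof -
    have "frob ?Y (G * ?Y * B) = frob (G * ?Y * B) (V * Z * (Wt * Mt))"
      by (rule frob_commute) auto
    also have "\<dots> = frob (Ghat V G * Z * Bhat m W) Z"
      by (subst frob_sandwich) (auto simp: transpose_mult_dims mult_assoc_dims Ghat_def Bhat_def)
    also have "\<dots> = frob Z (Ghat V G * Z * Bhat m W)"
      by (rule frob_commute) (auto simp: Ghat_def Bhat_def)
    finally show ?thesis .
  qed
  moreover have "frob (embed c Z) (G * embed c Z * B)
      = c * (c * frob ?H (G * ?H * B)) + c * frob ?H (G * ?Y * B) + c * frob ?Y (G * ?H * B) + frob ?Y (G * ?Y * B)"
    unfolding e
    by (simp add: add_mult_dims mult_smult_dims frob_add_left frob_add_right frob_smult_left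
        frob_smult_right algebra_simps)
  ultimately have main: "frob (embed c Z) (G * embed c Z * B)
      = c\<^sup>2 * alpha n m G + c * trace_mat (Cmat n m G V W * transpose_mat Z) + frob Z (Ghat V G * Z * Bhat m W)"
    unfolding cross alpha_eq_frob[OF G] by (simp add: power2_eq_square algebra_simps)
  have "embed c Z \<in> carrier_mat n k" by (auto intro: carrier_matI)
  then show ?thesis
    using quad_form_Qhat[OF Bhat_symmetric Ghat_symmetric[OF G] S T Z] T
    by (simp add: quad_form_Qtilde[OF G S T] Vt_embed_Mt_inv[OF Z] embed_Mt_inv_W[OF Z] main
        frob_mult_Wt[OF S Z] frob_V_mult[OF _ Z] sym_mat_def)
qed

lemma qp_objective_eq:
  assumes "G \<in> sym_mat n" "S \<in> carrier_mat (n - 1) (n - 1)" "T \<in> sym_mat (k - 1)"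
    "Z \<in> carrier_mat (n - 1) (k - 1)"
  shows "qp_objective n m G V W S T Z
    = 1/2 * quad_form (Qtilde n m G V W S T) (vec_stack (embed 1 Z)) + 1/2 * eig_term (Ghat V G) (Bhat m W)"
  unfolding quad_form_Qtilde_embed[OF assms] qp_objective_def by (simp add: field_simps)

lemma qp_feasible_iff:
  "Z \<in> qp_feasible n m V W \<longleftrightarrow> Z \<in> carrier_mat (n - 1) (k - 1) \<and> embed 1 Z \<in> nonneg_set n m"
proof (cases "Z \<in> carrier_mat (n - 1) (k - 1)")
  case True
  then have [simp]: "dim_row Z = n - 1" "dim_col Z = k - 1" by auto
  have "embed 1 Z $$ (i, j) = Xhat n m $$ (i, j) + (V * Z * Wt * Mt) $$ (i, j)" if "i < n" "j < k" for i j
    using that by (simp add: embed_def del: index_mult_mat(1))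
  then have "(V * Z * Wt * Mt) $$ (i, j) \<ge> - (Xhat n m $$ (i, j)) \<longleftrightarrow> embed 1 Z $$ (i, j) \<ge> 0"
    if "i < n" "j < k" for i j
    using that by (simp del: index_mult_mat(1)) linarith
  then show ?thesis
    using True embed_in_affine_set[OF True]
    by (simp add: qp_feasible_def nonneg_set_def del: index_mult_mat(1))
qed (auto simp: qp_feasible_def)

end

section \<open>Spectral decompositions\<close>

lemma eig_decompD:
  assumes "eig_decomp D U lam" "dim_row D = r"
  shows "U \<in> carrier_mat r r" "dim_row U = r" "dim_col U = r" "dim_vec lam = r"
    "transpose_mat U * U = 1\<^sub>m r" "U * transpose_mat U = 1\<^sub>m r" "D = U * diag_of_vec lam * transpose_mat U"
proof -
  show U: "U \<in> carrier_mat r r" "dim_row U = r" "dim_col U = r" "dim_vec lam = r"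
    "transpose_mat U * U = 1\<^sub>m r" "D = U * diag_of_vec lam * transpose_mat U"
    using assms by (auto simp: eig_decomp_def orthogonal_matrix_def)
  show "U * transpose_mat U = 1\<^sub>m r"
    using mat_mult_left_right_inverse[of "transpose_mat U" r U] U by simp
qed

lemma proots_char_poly_eig_decomp:
  assumes "eig_decomp D U lam" "dim_row D = r"
  shows "proots (char_poly D) = mset (list_of_vec lam)"
proof -
  note U = eig_decompD[OF assms]
  let ?L = "diag_of_vec lam"
  have L: "?L \<in> carrier_mat r r" using U(4) by (auto intro: carrier_matI)
  have "similar_mat D ?L"
    unfolding similar_mat_def similar_mat_wit_def Let_def
    by (rule exI[of _ U], rule exI[of _ "transpose_mat U"]) (use U L assms(2) in auto)
  then have "char_poly D = char_poly ?L" by (rule char_poly_similar)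
  also have "\<dots> = (\<Prod>a\<leftarrow>diag_mat ?L. [:- a, 1:])"
    by (rule char_poly_upper_triangular[OF L]) (use U(4) in \<open>auto simp: upper_triangular_def\<close>)
  also have "diag_mat ?L = list_of_vec lam"
    by (rule nth_equalityI) (auto simp: diag_mat_def list_of_vec_index)
  finally have "char_poly D = (\<Prod>a\<leftarrow>list_of_vec lam. [:- a, 1:])" .
  moreover have "proots (\<Prod>a\<leftarrow>xs. [:- a, 1:]) = mset xs" for xs :: "real list"
  proof (induction xs)
    case (Cons a xs)
    have "(\<Prod>a\<leftarrow>xs. [:- a, 1:]) \<noteq> (0 :: real poly)"
      by (auto simp: prod_list_zero_iff)
    then show ?case
      using Cons by (simp add: proots_mult del: mult_pCons_left)
  qed simp
  ultimately show ?thesis by simp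
qed

lemma mset_eigvals:
  assumes "eig_decomp D U lam" "dim_row D = r"
  shows "mset (list_of_vec (eigvals D)) = mset (list_of_vec lam)"
  unfolding eigvals_def proots_char_poly_eig_decomp[OF assms] by (simp add: list_vec)

lemma diag_conjugate_symmetric:
  assumes "U \<in> carrier_mat r r" "dim_vec v = r"
  shows "U * diag_of_vec v * transpose_mat U \<in> sym_mat r"
  using assms by (auto simp: sym_mat_def transpose_mult_dims mult_assoc_dims intro!: carrier_matI)

lemma frob_diag_conjugate:
  assumes U: "U \<in> carrier_mat b b" "dim_vec s = b" and P: "P \<in> carrier_mat a a" "dim_vec t = a"
    and Z: "Z \<in> carrier_mat b a"
  shows "frob Z ((U * diag_of_vec s * transpose_mat U) * Z * (P * diag_of_vec t * transpose_mat P))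
    = (\<Sum>j<b. \<Sum>i<a. s $ j * t $ i * ((transpose_mat U * Z * P) $$ (j, i))\<^sup>2)"
proof -
  have [simp]: "dim_row U = b" "dim_col U = b" "dim_row P = a" "dim_col P = a" "dim_row Z = b" "dim_col Z = a"
    using assms by auto
  let ?Y = "transpose_mat U * Z * P"
  have "(U * diag_of_vec s * transpose_mat U) * Z * (P * diag_of_vec t * transpose_mat P)
      = U * (diag_of_vec s * ?Y * diag_of_vec t) * transpose_mat P"
    using U P by (simp add: mult_assoc_dims)
  then have "frob Z ((U * diag_of_vec s * transpose_mat U) * Z * (P * diag_of_vec t * transpose_mat P))
    = frob ?Y (diag_of_vec s * ?Y * diag_of_vec t)"
    using U P by (simp add: frob_sandwich)
  also have "\<dots> = (\<Sum>j<b. \<Sum>i<a. s $ j * t $ i * (?Y $$ (j, i))\<^sup>2)"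
    using U P
    by (simp add: frob_def diag_of_vec_mult_entry mult_diag_of_vec_entry power2_eq_square mult_ac
        del: index_mult_mat(1))
  finally show ?thesis .
qed

lemma one_mat_eq_conjugate:
  assumes "U * transpose_mat U = 1\<^sub>m r" "dim_col U = r"
  shows "1\<^sub>m r = U * diag_of_vec (ones_vec r) * transpose_mat U"
proof -
  have "diag_of_vec (ones_vec r) = 1\<^sub>m r" by (auto intro!: eq_matI)
  with assms show ?thesis by simp
qed

locale spectral_pair =
  fixes a b :: nat and Bh Gh U1 U2 :: "real mat" and lam sig :: "real vec"
  assumes dim_Bh: "dim_row Bh = a" and dim_Gh: "dim_row Gh = b"
    and eig1: "eig_decomp Bh U1 lam" and eig2: "eig_decomp Gh U2 sig"
begin

lemmas U1 = eig_decompD[OF eig1 dim_Bh]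
lemmas U2 = eig_decompD[OF eig2 dim_Gh]

abbreviation "S_of v \<equiv> U2 * diag_of_vec v * transpose_mat U2"
abbreviation "T_of v \<equiv> U1 * diag_of_vec v * transpose_mat U1"

lemma Bh_symmetric: "Bh \<in> sym_mat a" and Gh_symmetric: "Gh \<in> sym_mat b"
  using diag_conjugate_symmetric[OF U1(1,4)] diag_conjugate_symmetric[OF U2(1,4)] U1(7) U2(7) by auto

lemma dims [simp]:
  "dim_row U1 = a" "dim_col U1 = a" "dim_row U2 = b" "dim_col U2 = b" "dim_vec lam = a" "dim_vec sig = b"
  "dim_row Bh = a" "dim_col Bh = a" "dim_row Gh = b" "dim_col Gh = b"
  using U1(2-4) U2(2-4) Bh_symmetric Gh_symmetric by (auto simp: sym_mat_def)

text \<open>Rotating \<open>Z\<close> into the two eigenbases makes all three terms of \<open>Qhat\<close> diagonal at once, the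
  identity factors included.\<close>

lemma quad_form_Qhat_diag:
  assumes s: "dim_vec s = b" and t: "dim_vec t = a" and Z: "Z \<in> carrier_mat b a"
  shows "quad_form (Qhat Bh Gh (S_of s) (T_of t)) (vec_stack Z)
    = (\<Sum>j<b. \<Sum>i<a. (lam $ i * sig $ j - s $ j - t $ i) * ((transpose_mat U2 * Z * U1) $$ (j, i))\<^sup>2)"
proof -
  have [simp]: "dim_row Z = b" "dim_col Z = a" using Z by auto
  let ?Y = "transpose_mat U2 * Z * U1"
  have "frob Z (S_of s * Z) = frob Z (S_of s * Z * 1\<^sub>m a)" using s by simp
  also have "\<dots> = (\<Sum>j<b. \<Sum>i<a. s $ j * (?Y $$ (j, i))\<^sup>2)"
    unfolding one_mat_eq_conjugate[OF U1(6,3)]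
    by (subst frob_diag_conjugate[OF U2(1) s U1(1) _ Z]) auto
  finally have S: "frob Z (S_of s * Z) = (\<Sum>j<b. \<Sum>i<a. s $ j * (?Y $$ (j, i))\<^sup>2)" .
  have "frob Z (Z * T_of t) = frob Z (1\<^sub>m b * Z * T_of t)" by simp
  also have "\<dots> = (\<Sum>j<b. \<Sum>i<a. t $ i * (?Y $$ (j, i))\<^sup>2)"
    unfolding one_mat_eq_conjugate[OF U2(6,3)]
    by (subst frob_diag_conjugate[OF U2(1) _ U1(1) t Z]) auto
  finally have T: "frob Z (Z * T_of t) = (\<Sum>j<b. \<Sum>i<a. t $ i * (?Y $$ (j, i))\<^sup>2)" .
  have M: "frob Z (Gh * Z * Bh) = (\<Sum>j<b. \<Sum>i<a. sig $ j * lam $ i * (?Y $$ (j, i))\<^sup>2)"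
    by (subst U1(7), subst U2(7), rule frob_diag_conjugate[OF U2(1,4) U1(1,4) Z])
  show ?thesis
    using diag_conjugate_symmetric[OF U2(1) s] diag_conjugate_symmetric[OF U1(1) t]
    by (subst quad_form_Qhat[OF Bh_symmetric Gh_symmetric _ _ Z])
      (auto simp: sym_mat_def S T M algebra_simps simp flip: sum_subtractf simp del: index_mult_mat(1))
qed

lemma quad_form_Qhat_nonneg:
  assumes "(s, t) \<in> lp_feasible lam sig" "Z \<in> carrier_mat b a"
  shows "quad_form (Qhat Bh Gh (S_of s) (T_of t)) (vec_stack Z) \<ge> 0"
proof -
  have st: "dim_vec s = b" "dim_vec t = a"
    and le: "t $ i + s $ j \<le> lam $ i * sig $ j" if "i < a" "j < b" for i j
    using assms(1) that by (auto simp: lp_feasible_def)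
  have "0 \<le> lam $ i * sig $ j - s $ j - t $ i" if "i < a" "j < b" for i j
    using le[OF that] by simp
  then show ?thesis
    using assms by (subst quad_form_Qhat_diag) (auto simp: lp_feasible_def intro!: sum_nonneg mult_nonneg_nonneg)
qed

lemma Qhat_symmetric:
  assumes "S \<in> sym_mat b" "T \<in> sym_mat a"
  shows "Qhat Bh Gh S T \<in> sym_mat (a * b)"
proof -
  have [simp]: "dim_row S = b" "dim_col S = b" "dim_row T = a" "dim_col T = a" 
    and t: "transpose_mat Bh = Bh" "transpose_mat Gh = Gh" "transpose_mat S = S" "transpose_mat T = T"
    using assms Bh_symmetric Gh_symmetric by (auto simp: sym_mat_def)
  have "transpose_mat (P - Q) = transpose_mat P - transpose_mat Q"
    if "dim_row P = dim_row Q" "dim_col P = dim_col Q" for P Q :: "real mat"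
    using that by (intro eq_matI) auto
  then show ?thesis
    by (auto simp: sym_mat_def Qhat_def transpose_kron t transpose_one intro!: carrier_matI)
qed

lemma Qhat_eq_diff:
  assumes "S \<in> sym_mat b" "T \<in> sym_mat a"
  shows "(Bh \<otimes>\<^sub>m Gh) - ((1\<^sub>m a \<otimes>\<^sub>m S) + (T \<otimes>\<^sub>m 1\<^sub>m b)) = Qhat Bh Gh S T"
  using assms by (intro eq_matI) (auto simp: Qhat_def sym_mat_def)

lemma quad_form_diag_conjugate_nonpos:
  assumes "dim_vec s = b" "\<And>j. j < b \<Longrightarrow> s $ j \<le> 0" "x \<in> carrier_vec b"
  shows "quad_form (S_of s) x \<le> 0"
proof -
  let ?y = "transpose_mat U2 *\<^sub>v x"
  have y: "?y \<in> carrier_vec b" by (auto intro: carrier_vecI)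
  have D: "diag_of_vec s \<in> carrier_mat b b" using assms by (auto intro: carrier_matI)
  have "S_of s *\<^sub>v x = U2 *\<^sub>v (diag_of_vec s *\<^sub>v ?y)"
    using U2(1) D y assms(3) by (simp add: assoc_mult_mat_vec[of _ b b _ b])
  then have "quad_form (S_of s) x = ?y \<bullet> (diag_of_vec s *\<^sub>v ?y)"
    unfolding quad_form_def
    by (simp, subst transpose_vec_mult_scalar[OF U2(1) _ assms(3), symmetric])
      (use D y in auto)
  also have "\<dots> = (\<Sum>j<b. s $ j * (?y $ j)\<^sup>2)"
  proof -
    have "(diag_of_vec s *\<^sub>v ?y) $ j = s $ j * ?y $ j" if "j < b" for j
    proof -
      have "(diag_of_vec s *\<^sub>v ?y) $ j = (\<Sum>l<b. (if j = l then s $ j else 0) * ?y $ l)"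
        using that assms(1) by (simp add: scalar_prod_def atLeast0LessThan)
      also have "\<dots> = s $ j * ?y $ j" using that by (subst sum.remove[of _ j]) auto
      finally show ?thesis .
    qed
    then show ?thesis
      using assms(1) by (simp add: scalar_prod_def atLeast0LessThan power2_eq_square mult_ac del: index_mult_mat_vec)
  qed
  also have "\<dots> \<le> 0"
    using assms(2) by (intro sum_nonpos mult_nonpos_nonneg) auto
  finally show ?thesis .
qed

lemma sdp_feasible_diag:
  assumes "(s, t) \<in> lp_feasible lam sig"
  shows "(S_of s, T_of t) \<in> sdp_feasible Bh Gh"
proof -
  have st: "dim_vec s = b" "dim_vec t = a" "\<And>j. j < b \<Longrightarrow> s $ j \<le> 0"
    using assms by (auto simp: lp_feasible_def)
  have S: "S_of s \<in> sym_mat b" and T: "T_of t \<in> sym_mat a"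
    using diag_conjugate_symmetric U1 U2 st by blast+
  have "quad_form (Qhat Bh Gh (S_of s) (T_of t)) x \<ge> 0" if x: "x \<in> carrier_vec (a * b)" for x
  proof -
    obtain Z where "Z \<in> carrier_mat b a" "x = vec_stack Z"
      using x by (metis vec_stack_surj mult.commute)
    then show ?thesis using quad_form_Qhat_nonneg[OF assms] by blast
  qed
  then have "psd (Qhat Bh Gh (S_of s) (T_of t))"
    using Qhat_symmetric[OF S T] by (auto simp: psd_def)
  moreover have "psd (0\<^sub>m b b - S_of s)"
  proof -
    have "0\<^sub>m b b - S_of s \<in> sym_mat b"
      using S by (auto simp: sym_mat_def transpose_minus[of _ b b])
    moreover have "quad_form (0\<^sub>m b b - S_of s) x = - quad_form (S_of s) x" if "x \<in> carrier_vec b" for x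
      using that st(1) by (subst quad_form_diff) (auto simp: quad_form_eq_sum)
    ultimately show ?thesis
      using quad_form_diag_conjugate_nonpos[OF st(1,3)] by (auto simp: psd_def)
  qed
  ultimately show ?thesis
    using S T Qhat_eq_diff[OF S T] by (auto simp: sdp_feasible_def loewner_le_def)
qed

text \<open>Testing the two semidefinite constraints on \<open>u\<^sub>i \<otimes> v\<^sub>j\<close> and on \<open>v\<^sub>j\<close>, for eigenvectors \<open>u\<^sub>i\<close> of
  the left and \<open>v\<^sub>j\<close> of the right factor, sees only the diagonals of the conjugated matrices,
  and conjugation preserves the trace.\<close>

lemma sdp_feasible_to_lp:
  assumes "(S, T) \<in> sdp_feasible Bh Gh"
  obtains s t where "(s, t) \<in> lp_feasible lam sig" "sdp_objective S T = lp_objective s t"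
proof
  have S: "S \<in> sym_mat b" and T: "T \<in> sym_mat a"
    and Q: "psd (Qhat Bh Gh S T)" and N: "psd (0\<^sub>m b b - S)"
    using assms Qhat_eq_diff[of S T] by (auto simp: sdp_feasible_def loewner_le_def)
  have [simp]: "dim_row S = b" "dim_col S = b" "dim_row T = a" "dim_col T = a"
    using S T by (auto simp: sym_mat_def)
  define S' where "S' = transpose_mat U2 * S * U2"
  define T' where "T' = transpose_mat U1 * T * U1"
  have [simp]: "dim_row S' = b" "dim_col S' = b" "dim_row T' = a" "dim_col T' = a"
    by (auto simp: S'_def T'_def)
  define s where "s = vec b (\<lambda>j. S' $$ (j, j))"
  define t where "t = vec a (\<lambda>i. T' $$ (i, i))"
  have "t $ i + s $ j \<le> lam $ i * sig $ j" if i: "i < a" and j: "j < b" for i j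
  proof -
    define E :: "real mat" where "E = mat b a (\<lambda>(p, q). if p = j \<and> q = i then 1 else 0)"
    have [simp]: "dim_row E = b" "dim_col E = a" by (auto simp: E_def)
    have frobE: "frob E K = K $$ (j, i)" for K
    proof -
      have "frob E K = (\<Sum>p<b. \<Sum>q<a. if q = i then (if p = j then K $$ (p, q) else 0) else 0)"
        unfolding frob_def by (intro sum.cong) (simp_all add: E_def)
      then show ?thesis using i j by simp
    qed
    have EK: "(K * E) $$ (j, i) = K $$ (j, j)" if "dim_row K = b" "dim_col K = b" for K
    proof -
      have "(K * E) $$ (j, i) = (\<Sum>l<b. K $$ (j, l) * E $$ (l, i))"
        using i j that by (simp add: mult_mat_entry del: index_mult_mat(1))
      also have "\<dots> = (\<Sum>l<b. if l = j then K $$ (j, l) else 0)"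
        using i by (intro sum.cong) (simp_all add: E_def)
      finally show ?thesis using j by simp
    qed
    have KE: "(E * K) $$ (j, i) = K $$ (i, i)" if "dim_row K = a" "dim_col K = a" for K
    proof -
      have "(E * K) $$ (j, i) = (\<Sum>l<a. E $$ (j, l) * K $$ (l, i))"
        using i j that by (simp add: mult_mat_entry del: index_mult_mat(1))
      also have "\<dots> = (\<Sum>l<a. if l = i then K $$ (l, i) else 0)"
        using j by (intro sum.cong) (simp_all add: E_def)
      finally show ?thesis using i by simp
    qed
    \<comment> \<open>the matrix form of the product of the \<open>i\<close>-th and \<open>j\<close>-th eigenvectors\<close>
    let ?Z = "U2 * E * transpose_mat U1"
    have Z: "?Z \<in> carrier_mat b a" by (auto intro: carrier_matI)
    have eqs: "transpose_mat U2 * ?Z * U1 = (transpose_mat U2 * U2) * E * (transpose_mat U1 * U1)"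
      "transpose_mat U2 * (?Z * T) * U1 = (transpose_mat U2 * U2) * E * (transpose_mat U1 * T * U1)"
      "transpose_mat U2 * (S * ?Z) * U1 = (transpose_mat U2 * S * U2) * E * (transpose_mat U1 * U1)"
      by (simp_all add: mult_assoc_dims)
    have sand: "frob ?Z K = frob E (transpose_mat U2 * K * U1)" if "dim_row K = b" "dim_col K = a" for K
    proof -
      have "frob ?Z K = frob K (U2 * E * transpose_mat U1)"
        using that by (intro frob_commute) auto
      also have "\<dots> = frob (transpose_mat U2 * K * U1) E"
        using that by (subst frob_sandwich) auto
      also have "\<dots> = frob E (transpose_mat U2 * K * U1)"
        by (rule frob_commute) auto
      finally show ?thesis .
    qed
    have ZS: "frob ?Z (S * ?Z) = s $ j"
    proof -
      have "frob ?Z (S * ?Z) = frob E (S' * E * 1\<^sub>m a)"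
        by (subst sand) (simp_all only: eqs S'_def U1(5), simp_all)
      also have "S' * E * 1\<^sub>m a = S' * E" by simp
      finally show ?thesis using j by (simp only: frobE EK s_def) (simp add: EK del: index_mult_mat(1))
    qed
    have ZT: "frob ?Z (?Z * T) = t $ i"
    proof -
      have "frob ?Z (?Z * T) = frob E (1\<^sub>m b * E * T')"
        by (subst sand) (simp_all only: eqs T'_def U2(5), simp_all)
      also have "1\<^sub>m b * E * T' = E * T'" by simp
      finally show ?thesis using i by (simp only: frobE KE t_def) (simp add: KE del: index_mult_mat(1))
    qed
    have "transpose_mat U2 * ?Z * U1 = E"
      unfolding eqs by (simp add: U1(5) U2(5))
    then have "frob ?Z (Gh * ?Z * Bh) = (\<Sum>p<b. \<Sum>q<a. sig $ p * lam $ q * (E $$ (p, q))\<^sup>2)"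
      using frob_diag_conjugate[OF U2(1,4) U1(1,4) Z] U1(7) U2(7) by simp
    also have "\<dots> = (\<Sum>p<b. \<Sum>q<a. if q = i then (if p = j then sig $ p * lam $ q else 0) else 0)"
      by (intro sum.cong) (simp_all add: E_def)
    also have "\<dots> = sig $ j * lam $ i" using i j by simp
    finally have ZGB: "frob ?Z (Gh * ?Z * Bh) = sig $ j * lam $ i" .
    have "0 \<le> quad_form (Qhat Bh Gh S T) (vec_stack ?Z)"
      using Q by (auto simp: psd_def mult.commute intro!: carrier_vecI)
    also have "\<dots> = sig $ j * lam $ i - s $ j - t $ i"
      using S by (subst quad_form_Qhat[OF Bh_symmetric Gh_symmetric _ T Z]) (simp_all only: ZGB ZS ZT, simp add: sym_mat_def)
    finally show ?thesis by (simp add: mult.commute)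
  qed
  moreover have "s $ j \<le> 0" if j: "j < b" for j
  proof -
    have c: "col U2 j \<in> carrier_vec b" by (auto intro: carrier_vecI)
    have "S' $$ (j, j) = quad_form S (col U2 j)"
      using j by (simp add: S'_def mult_assoc_dims quad_form_def col_mult2[of _ b b _ b] carrier_matI)
    moreover have "quad_form (0\<^sub>m b b - S) (col U2 j) = - quad_form S (col U2 j)"
      by (subst quad_form_diff) (auto simp: quad_form_eq_sum)
    moreover have "quad_form (0\<^sub>m b b - S) (col U2 j) \<ge> 0"
      using N c by (auto simp: psd_def)
    ultimately show ?thesis using j by (simp add: s_def)
  qed
  ultimately show "(s, t) \<in> lp_feasible lam sig"
    by (auto simp: lp_feasible_def s_def t_def)
  have tr: "trace_mat (transpose_mat U * K * U) = trace_mat K"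
    if "dim_row K = r" "dim_col K = r" "dim_row U = r" "dim_col U = r" "U * transpose_mat U = 1\<^sub>m r" for U K :: "real mat" and r
    using that by (simp add: trace_mat_eq_frob_one frob_sandwich)
  have ss: "ones_vec (dim_vec v) \<bullet> v = (\<Sum>i<dim_vec v. v $ i)" for v
    by (simp add: scalar_prod_def atLeast0LessThan)
  have st: "trace_mat K = (\<Sum>i<dim_row K. K $$ (i, i))" for K
    by (simp add: trace_mat_def diag_mat_def interv_sum_list_conv_sum_set_nat atLeast0LessThan)
  have "trace_mat S = trace_mat S'" "trace_mat T = trace_mat T'"
    unfolding S'_def T'_def by (simp_all add: tr U1(6) U2(6))
  then show "sdp_objective S T = lp_objective s t"
    unfolding sdp_objective_def lp_objective_def ss by (simp add: s_def t_def st)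
qed

lemma trace_diag_conjugate:
  assumes "dim_vec v = r" "U \<in> carrier_mat r r" "transpose_mat U * U = 1\<^sub>m r"
  shows "trace_mat (U * diag_of_vec v * transpose_mat U) = ones_vec r \<bullet> v"
proof -
  have [simp]: "dim_row U = r" "dim_col U = r" using assms by auto
  have "trace_mat (U * diag_of_vec v * transpose_mat U) = trace_mat (diag_of_vec v)"
    using assms by (simp add: trace_mat_eq_frob_one frob_sandwich)
  then show ?thesis
    using assms(1)
    by (simp add: trace_mat_def diag_mat_def interv_sum_list_conv_sum_set_nat atLeast0LessThan scalar_prod_def)
qed

lemma sdp_optimal_diag:
  assumes "lp_optimal lam sig s t"
  shows "sdp_optimal Bh Gh (S_of s) (T_of t)"
proof -
  have f: "(s, t) \<in> lp_feasible lam sig" using assms by (simp add: lp_optimal_def)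
  then have "dim_vec s = b" "dim_vec t = a" by (auto simp: lp_feasible_def)
  then have "sdp_objective (S_of s) (T_of t) = lp_objective s t"
    using U1(1,5) U2(1,5) by (simp add: sdp_objective_def lp_objective_def trace_diag_conjugate)
  moreover have "sdp_objective S' T' \<le> lp_objective s t" if ST: "(S', T') \<in> sdp_feasible Bh Gh" for S' T'
  proof -
    obtain s' t' where "(s', t') \<in> lp_feasible lam sig" "sdp_objective S' T' = lp_objective s' t'"
      using sdp_feasible_to_lp[OF ST] by blast
    then show ?thesis using assms by (auto simp: lp_optimal_def)
  qed
  ultimately show ?thesis
    using sdp_feasible_diag[OF f] by (auto simp: sdp_optimal_def)
qed

end

section \<open>Linear programming duality for product costs\<close>

text \<open>With \<open>u\<close> nonincreasing and \<open>v\<close> nondecreasing, \<open>\<tau>\<close> is the concave piecewise linear function of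
  the values of \<open>u\<close> whose slope at the \<open>l\<close>-th value is the \<open>l\<close>-th entry of \<open>v\<close>; the bound is
  its supergradient inequality.\<close>

lemma sorted_supergradient:
  fixes u v :: "nat \<Rightarrow> real"
  assumes u: "\<And>l. Suc l < N \<Longrightarrow> u (Suc l) \<le> u l" and v: "\<And>l l'. l \<le> l' \<Longrightarrow> l' < N \<Longrightarrow> v l \<le> v l'"
    and l: "l < N" "l' < N"
  defines "\<tau> \<equiv> \<lambda>l. \<Sum>r<l. (u (Suc r) - u r) * v r"
  shows "\<tau> l - \<tau> l' \<le> (u l - u l') * v l'"
proof (cases "l' \<le> l")
  case True
  then show ?thesis using l(1)
  proof (induction rule: dec_induct)
    case (step r)
    have "(u (Suc r) - u r) * v r \<le> (u (Suc r) - u r) * v l'"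
      using u[of r] v[of l' r] step by (intro mult_left_mono_neg) auto
    with step show ?case by (simp add: \<tau>_def algebra_simps)
  qed simp
next
  case False
  then have "l \<le> l'" by simp
  then show ?thesis
  proof (induction rule: inc_induct)
    case (step r)
    have "(u r - u (Suc r)) * v r \<le> (u r - u (Suc r)) * v l'"
      using u[of r] v[of r l'] step l by (intro mult_left_mono) auto
    with step show ?case by (simp add: \<tau>_def algebra_simps)
  qed simp
qed

text \<open>Pairing the largest values of \<open>y\<close> with the smallest ones of \<open>x\<close> is optimal for the product
  cost, and this is certified by dual variables: \<open>t\<close> is the concave function above, \<open>s\<close> makes the
  chosen pairs tight. That \<open>t\<close> depends on the value of \<open>y\<close> only is what later permits \<open>t = 0\<close> on all
  padded zeros at once.\<close>

lemma antisorted_potentials: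
  fixes x y :: "nat \<Rightarrow> real"
  obtains \<phi> s t where "\<phi> permutes {..<N}"
    "\<And>i j. i < N \<Longrightarrow> j < N \<Longrightarrow> t i + s j \<le> y i * x j"
    "\<And>i. i < N \<Longrightarrow> t i + s (\<phi> i) = y i * x (\<phi> i)"
    "\<And>i j. i < N \<Longrightarrow> j < N \<Longrightarrow> y i = y j \<Longrightarrow> t i = t j"
proof -
  define ps where "ps = sort_key (\<lambda>i. - y i) [0..<N]"
  define qs where "qs = sort_key x [0..<N]"
  have ps: "length ps = N" "bij_betw ((!) ps) {..<N} {..<N}"
    and qs: "length qs = N" "bij_betw ((!) qs) {..<N} {..<N}"
    by (auto simp: ps_def qs_def atLeast0LessThan intro!: bij_betw_nth)
  define u where "u = (\<lambda>l. y (ps ! l))"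
  define v where "v = (\<lambda>l. x (qs ! l))"
  have sp: "sorted (map (\<lambda>i. - y i) ps)" and sq: "sorted (map x qs)"
    by (simp_all add: ps_def qs_def)
  have u: "u (Suc l) \<le> u l" if "Suc l < N" for l
    using sorted_nth_mono[OF sp, of l "Suc l"] that ps(1) by (simp add: u_def)
  have v: "v l \<le> v l'" if "l \<le> l'" "l' < N" for l l'
    using sorted_nth_mono[OF sq, of l l'] that qs(1) by (simp add: v_def)
  define \<tau> where "\<tau> = (\<lambda>l. \<Sum>r<l. (u (Suc r) - u r) * v r)"
  have \<tau>: "\<tau> l - \<tau> l' \<le> (u l - u l') * v l'" if "l < N" "l' < N" for l l'
    using sorted_supergradient[of N u v l l'] u v that by (simp add: \<tau>_def)
  define a where "a = inv_into {..<N} ((!) ps)"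
  define b where "b = inv_into {..<N} ((!) qs)"
  have a: "a i < N" "ps ! a i = i" and b: "b i < N" "qs ! b i = i" if "i < N" for i
    using bij_betw_inv_into_right[OF ps(2), of i] bij_betw_inv_into_right[OF qs(2), of i]
      bij_betwE[OF bij_betw_inv_into[OF ps(2)]] bij_betwE[OF bij_betw_inv_into[OF qs(2)]] that
    by (auto simp: a_def b_def)
  have bq: "b (qs ! l) = l" if "l < N" for l
    using bij_betw_inv_into_left[OF qs(2)] that by (auto simp: b_def)
  define \<phi> where "\<phi> = (\<lambda>i. if i < N then qs ! a i else i)"
  define t where "t = (\<lambda>i. \<tau> (a i))"
  define s where "s = (\<lambda>j. u (b j) * v (b j) - \<tau> (b j))"
  show ?thesis
  proof
    have "bij_betw ((!) qs \<circ> a) {..<N} {..<N}"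
      using bij_betw_trans[OF bij_betw_inv_into[OF ps(2)] qs(2)] by (simp add: a_def)
    then have "bij_betw \<phi> {..<N} {..<N}"
      by (rule bij_betw_cong[THEN iffD1, rotated]) (simp add: \<phi>_def)
    then show "\<phi> permutes {..<N}"
      by (rule bij_imp_permutes) (simp add: \<phi>_def)
    show "t i + s j \<le> y i * x j" if "i < N" "j < N" for i j
      using \<tau>[of "a i" "b j"] a[OF that(1)] b[OF that(2)]
      by (simp add: t_def s_def u_def v_def algebra_simps)
    show "t i + s (\<phi> i) = y i * x (\<phi> i)" if "i < N" for i
      using a[OF that] that by (simp add: t_def s_def \<phi>_def bq u_def v_def)
    show "t i = t j" if "i < N" "j < N" "y i = y j" for i j
      using \<tau>[of "a i" "a j"] \<tau>[of "a j" "a i"] a[OF that(1)] a[OF that(2)] that(3)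
      by (simp add: t_def u_def)
  qed
qed

lemma min_sprod_le:
  assumes "\<phi> permutes {..<dim_vec y}"
  shows "min_sprod x y \<le> (\<Sum>i<dim_vec y. x $ (\<phi> i) * y $ i)"
proof -
  have "{(\<Sum>i<dim_vec y. x $ (\<phi> i) * y $ i) | \<phi>. \<phi> permutes {..<dim_vec y}}
      = (\<lambda>\<phi>. \<Sum>i<dim_vec y. x $ (\<phi> i) * y $ i) ` {\<phi>. \<phi> permutes {..<dim_vec y}}"
    by auto
  then show ?thesis
    unfolding min_sprod_def using assms
    by (intro Min_le) (auto simp: finite_permutations)
qed

text \<open>The dual variables are determined up to a common shift. If some rows are padded, it is chosen
  such that they get \<open>t = 0\<close>, and their constraints become \<open>s \<le> 0\<close>; otherwise a large shift
  makes \<open>s\<close> nonpositive.\<close>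

lemma assignment_dual:
  fixes x y :: "real vec"
  assumes "dim_vec y = N" "K \<le> N" "\<And>i. K \<le> i \<Longrightarrow> i < N \<Longrightarrow> y $ i = 0"
  obtains s t where "\<And>i j. i < K \<Longrightarrow> j < N \<Longrightarrow> t i + s j \<le> y $ i * x $ j"
    "\<And>j. j < N \<Longrightarrow> s j \<le> 0" "min_sprod x y \<le> (\<Sum>j<N. s j) + (\<Sum>i<K. t i)"
proof -
  obtain \<phi> s0 t0 where \<phi>: "\<phi> permutes {..<N}"
    and le: "\<And>i j. i < N \<Longrightarrow> j < N \<Longrightarrow> t0 i + s0 j \<le> y $ i * x $ j"
    and eq: "\<And>i. i < N \<Longrightarrow> t0 i + s0 (\<phi> i) = y $ i * x $ (\<phi> i)"
    and val: "\<And>i j. i < N \<Longrightarrow> j < N \<Longrightarrow> y $ i = y $ j \<Longrightarrow> t0 i = t0 j"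
    using antisorted_potentials[of N "\<lambda>i. y $ i" "\<lambda>j. x $ j"] by metis
  define c where "c = (if K < N then - t0 K else (\<Sum>j<N. \<bar>s0 j\<bar>))"
  define s where "s = (\<lambda>j. s0 j - c)"
  define t where "t = (\<lambda>i. t0 i + c)"
  have pad: "t i = 0" if "K \<le> i" "i < N" for i
    using val[of i K] that assms(3) by (simp add: t_def c_def)
  have s: "s j \<le> 0" if "j < N" for j
  proof (cases "K < N")
    case True
    then show ?thesis using le[of K j] assms(3)[of K] that by (simp add: s_def c_def)
  next
    case False
    have "s0 j \<le> \<bar>s0 j\<bar>" by simp
    also have "\<dots> \<le> (\<Sum>j<N. \<bar>s0 j\<bar>)" using that by (intro member_le_sum) auto
    finally show ?thesis using False by (simp add: s_def c_def)
  qed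
  have "min_sprod x y \<le> (\<Sum>i<N. x $ (\<phi> i) * y $ i)"
    using min_sprod_le[of \<phi> y x] \<phi> assms(1) by simp
  also have "\<dots> = (\<Sum>i<N. t0 i + s0 (\<phi> i))"
    using eq by (intro sum.cong) (auto simp: mult.commute)
  also have "\<dots> = (\<Sum>i<N. t0 i) + (\<Sum>j<N. s0 j)"
    using sum.permute[OF \<phi>, of s0] by (simp add: sum.distrib o_def)
  also have "\<dots> = (\<Sum>i<N. t i) + (\<Sum>j<N. s j)"
    by (simp add: s_def t_def sum.distrib sum_subtractf)
  also have "(\<Sum>i<N. t i) = (\<Sum>i<K. t i)"
    using assms(2) pad by (intro sum.mono_neutral_right) auto
  finally have "min_sprod x y \<le> (\<Sum>j<N. s j) + (\<Sum>i<K. t i)" by simp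
  moreover have "t i + s j \<le> y $ i * x $ j" if "i < K" "j < N" for i j
    using le[of i j] that assms(2) by (simp add: s_def t_def)
  ultimately show ?thesis using that[of t s] s by blast
qed

lemma permutation_of_mset_eq:
  fixes u v :: "real vec"
  assumes "mset (list_of_vec v) = mset (list_of_vec u)"
  obtains p where "p permutes {..<dim_vec u}" "dim_vec v = dim_vec u" "\<And>i. i < dim_vec u \<Longrightarrow> u $ i = v $ p i"
proof -
  have d: "dim_vec v = dim_vec u"
    using mset_eq_length[OF assms] by simp
  obtain p where p: "p permutes {..<length (list_of_vec v)}" "permute_list p (list_of_vec v) = list_of_vec u"
    using mset_eq_permutation[OF assms[symmetric]] by blast
  have "u $ i = v $ p i" if "i < dim_vec u" for i
  proof -
    have pi: "p i < dim_vec u" using p(1) that d permutes_in_image[of p "{..<dim_vec u}" i] by simp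
    have "u $ i = permute_list p (list_of_vec v) ! i"
      using that by (simp add: p(2) list_of_vec_index)
    also have "\<dots> = v $ p i"
      using that p(1) d pi by (simp add: permute_list_nth list_of_vec_index)
    finally show ?thesis .
  qed
  with that p(1) d show ?thesis by simp
qed

context spectral_pair
begin

lemma lp_objective_eq_sum:
  "lp_objective s t = 1/2 * (\<Sum>j<dim_vec s. s $ j) + 1/2 * (\<Sum>i<dim_vec t. t $ i)"
  by (simp add: lp_objective_def scalar_prod_def atLeast0LessThan)

text \<open>The dual variables for the sorted spectra are transported along permutations to the order in
  which the given decompositions list the eigenvalues.\<close>

lemma eig_term_le_lp:
  assumes "a \<le> b" "lp_optimal lam sig s t"
  shows "eig_term Gh Bh \<le> 2 * lp_objective s t"
proof -
  obtain p where p: "p permutes {..<a}" "dim_vec (eigvals Bh) = a" "\<And>i. i < a \<Longrightarrow> lam $ i = eigvals Bh $ p i"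
    using permutation_of_mset_eq[OF mset_eigvals[OF eig1 dim_Bh]] by auto
  obtain q where q: "q permutes {..<b}" "dim_vec (eigvals Gh) = b" "\<And>j. j < b \<Longrightarrow> sig $ j = eigvals Gh $ q j"
    using permutation_of_mset_eq[OF mset_eigvals[OF eig2 dim_Gh]] by auto
  let ?x = "eigvals Gh" and ?y = "pad_zeros b (eigvals Bh)"
  have y: "dim_vec ?y = b" "\<And>i. i < a \<Longrightarrow> ?y $ i = eigvals Bh $ i"
    "\<And>i. a \<le> i \<Longrightarrow> i < b \<Longrightarrow> ?y $ i = 0"
    using assms(1) p(2) by (auto simp: pad_zeros_def)
  obtain s0 t0 where st: "\<And>i j. i < a \<Longrightarrow> j < b \<Longrightarrow> t0 i + s0 j \<le> ?y $ i * ?x $ j"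
    "\<And>j. j < b \<Longrightarrow> s0 j \<le> 0" "min_sprod ?x ?y \<le> (\<Sum>j<b. s0 j) + (\<Sum>i<a. t0 i)"
    using assignment_dual[of ?y b a ?x] y assms(1) by metis
  define s' where "s' = vec b (\<lambda>j. s0 (q j))"
  define t' where "t' = vec a (\<lambda>i. t0 (p i))"
  have pq: "p i < a" "q j < b" if "i < a" "j < b" for i j
    using that permutes_in_image[OF p(1), of i] permutes_in_image[OF q(1), of j] by auto
  have "q j < b" if "j < b" for j using that permutes_in_image[OF q(1), of j] by auto
  then have "(s', t') \<in> lp_feasible lam sig"
    using st(1)[OF pq] st(2) p(3) q(3) y(2) pq by (auto simp: lp_feasible_def s'_def t'_def)
  then have "lp_objective s' t' \<le> lp_objective s t"
    using assms(2) by (auto simp: lp_optimal_def)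
  moreover have "2 * lp_objective s' t' = (\<Sum>j<b. s0 j) + (\<Sum>i<a. t0 i)"
    using sum.permute[OF p(1), of t0] sum.permute[OF q(1), of s0]
    by (simp add: lp_objective_eq_sum s'_def t'_def o_def)
  ultimately show ?thesis using st(3) by (simp add: eig_term_def)
qed

end

section \<open>Existence of minimizers\<close>

text \<open>Matrices are encoded as functions on index pairs that vanish outside the format. There the
  feasible set is a closed subset of a product of unit intervals and of singletons, compact by
  Tychonoff's theorem.\<close>

lemma quad_form_attains_min:
  assumes Q: "dim_row Q = n * dim_vec m" "dim_col Q = n * dim_vec m" and ne: "nonneg_set n m \<noteq> {}"
  obtains X where "X \<in> nonneg_set n m"
    "\<And>X'. X' \<in> nonneg_set n m \<Longrightarrow> quad_form Q (vec_stack X) \<le> quad_form Q (vec_stack X')"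
proof -
  let ?k = "dim_vec m"
  let ?I = "{..<n} \<times> {..<?k}"
  define mk where "mk f = mat n ?k f" for f :: "nat \<times> nat \<Rightarrow> real"
  define K where "K = (PiE UNIV (\<lambda>p. if p \<in> ?I then {0..1} else {0}) :: (nat \<times> nat \<Rightarrow> real) set)
     \<inter> {f. \<forall>i<n. (\<Sum>j<?k. f (i, j)) = 1} \<inter> {f. \<forall>j<?k. (\<Sum>i<n. f (i, j)) = real (m $ j)}"
  have cont: "continuous_on UNIV (\<lambda>f :: nat \<times> nat \<Rightarrow> real. f p)" for p
    by (rule continuous_on_product_coordinates)
  have cI: "closed {f. \<forall>i<N. h i f = (c i :: real)}"
    if "\<And>i. continuous_on UNIV (h i)" for N :: nat and h c and f :: "nat \<times> nat \<Rightarrow> real"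
  proof -
    have "{f. \<forall>i<N. h i f = c i} = (\<Inter>i\<in>{..<N}. {f. h i f = c i})" by auto
    then show ?thesis using that by (auto intro!: closed_INT closed_Collect_eq continuous_intros)
  qed
  have "compactin (product_topology (\<lambda>_. euclidean) UNIV)
      (PiE UNIV (\<lambda>p. if p \<in> ?I then {0..1} else {0}) :: (nat \<times> nat \<Rightarrow> real) set)"
    unfolding compactin_PiE by auto
  then have "compact (PiE UNIV (\<lambda>p. if p \<in> ?I then {0..1} else {0}) :: (nat \<times> nat \<Rightarrow> real) set)"
    by (simp add: euclidean_product_topology)
  then have "compact K"
    unfolding K_def by (intro compact_Int_closed cI continuous_on_sum cont)
  have mk: "mk f \<in> nonneg_set n m" if "f \<in> K" for f
  proof -
    have f: "f (i, j) \<ge> 0" if "i < n" "j < ?k" for i j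
    proof -
      have "f (i, j) \<in> (if (i, j) \<in> ?I then {0..1} else {0})"
        using \<open>f \<in> K\<close> by (auto simp only: K_def Int_iff PiE_iff)
      with that show ?thesis by simp
    qed
    then show ?thesis using \<open>f \<in> K\<close>
      by (auto simp: mk_def K_def nonneg_set_def affine_set_def ones_vec_def real_vec_def scalar_prod_def atLeast0LessThan intro!: eq_vecI)
  qed
  have surj: "\<exists>f\<in>K. X = mk f" if X: "X \<in> nonneg_set n m" for X
  proof
    have d [simp]: "dim_row X = n" "dim_col X = ?k" and nonneg: "\<And>i j. i < n \<Longrightarrow> j < ?k \<Longrightarrow> X $$ (i, j) \<ge> 0"
      using X by (auto simp: nonneg_set_def affine_set_def)
    have eq: "X *\<^sub>v ones_vec ?k = ones_vec n" "transpose_mat X *\<^sub>v ones_vec n = real_vec m"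
      using X by (auto simp: nonneg_set_def affine_set_def)
    have row: "(\<Sum>j<?k. X $$ (i, j)) = 1" if "i < n" for i
      using arg_cong[OF eq(1), of "\<lambda>v. v $ i"] that
      by (simp add: ones_vec_def scalar_prod_def atLeast0LessThan)
    have col: "(\<Sum>i<n. X $$ (i, j)) = real (m $ j)" if "j < ?k" for j
      using arg_cong[OF eq(2), of "\<lambda>v. v $ j"] that
      by (simp add: ones_vec_def real_vec_def scalar_prod_def atLeast0LessThan)
    have le: "X $$ (i, j) \<le> 1" if "i < n" "j < ?k" for i j
      using member_le_sum[of j "{..<?k}" "\<lambda>j. X $$ (i, j)"] that nonneg row[OF that(1)] by auto
    let ?f = "\<lambda>p. if p \<in> ?I then X $$ p else 0"
    show "?f \<in> K" using nonneg le row col by (auto simp: K_def)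
    show "X = mk ?f" by (auto simp: mk_def intro!: eq_matI)
  qed
  have "continuous_on K (\<lambda>f. quad_form Q (vec_stack (mk f)))"
  proof -
    have "quad_form Q (vec_stack (mk f)) = (\<Sum>p<n * ?k. \<Sum>q<n * ?k.
        f (p mod n, p div n) * (Q $$ (p, q) * f (q mod n, q div n)))" for f
      using Q by (subst quad_form_eq_sum) (auto simp: mk_def vec_stack_def mod_div_less intro!: sum.cong)
    then show ?thesis
      by (simp, intro continuous_intros continuous_on_subset[OF cont]) auto
  qed
  moreover have "K \<noteq> {}" using ne surj by blast
  ultimately obtain f where "f \<in> K" "\<And>g. g \<in> K \<Longrightarrow> quad_form Q (vec_stack (mk f)) \<le> quad_form Q (vec_stack (mk g))"
    using continuous_attains_inf[OF \<open>compact K\<close>] by metis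
  with that[of "mk f"] mk surj show ?thesis by metis
qed

section \<open>Partitions as feasible matrices\<close>

text \<open>\<open>P = Y Y\<^sup>T\<close> is an orthogonal projection, so its diagonal entries satisfy \<open>p\<^sup>2 \<le> p\<close>, because
  \<open>p\<close> is the squared norm of a row that contains \<open>p\<close>.\<close>

lemma row_norm_le_one:
  fixes Y :: "real mat"
  assumes "Y \<in> carrier_mat b a" "transpose_mat Y * Y = 1\<^sub>m a" "j < b"
  shows "(\<Sum>i<a. (Y $$ (j, i))\<^sup>2) \<le> 1"
proof -
  have [simp]: "dim_row Y = b" "dim_col Y = a" using assms by auto
  define P where "P = Y * transpose_mat Y"
  have [simp]: "dim_row P = b" "dim_col P = b" by (auto simp: P_def)
  have sym: "P $$ (l, j) = P $$ (j, l)" if "l < b" for l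
    using that assms(3) by (simp add: P_def mult_mat_entry del: index_mult_mat(1)) (intro sum.cong refl mult.commute)
  have "P * P = Y * (transpose_mat Y * Y) * transpose_mat Y"
    by (simp add: P_def mult_assoc_dims)
  then have idem: "P * P = P" using assms(2) by (simp add: P_def)
  have "(P $$ (j, j))\<^sup>2 \<le> (\<Sum>l<b. (P $$ (j, l))\<^sup>2)"
    using assms(3) by (intro member_le_sum) auto
  also have "\<dots> = (P * P) $$ (j, j)"
    using assms(3) by (simp add: mult_mat_entry sym power2_eq_square del: index_mult_mat(1))
  finally have "(P $$ (j, j))\<^sup>2 \<le> P $$ (j, j)" by (simp add: idem)
  then have "P $$ (j, j) \<le> 1"
    by (smt (verit) mult_left_le_imp_le power2_eq_square mult_le_cancel_left1)
  moreover have "P $$ (j, j) = (\<Sum>i<a. (Y $$ (j, i))\<^sup>2)"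
    using assms(3) by (simp add: P_def mult_mat_entry power2_eq_square del: index_mult_mat(1))
  ultimately show ?thesis by simp
qed

context spectral_pair
begin

text \<open>In the eigenbasis each eigenvalue \<open>s\<^sub>j \<le> 0\<close> is weighted by the squared norm of a row of a
  matrix with orthonormal columns, hence by a factor of at most one.\<close>

lemma frob_S_lower:
  assumes Z: "Z \<in> carrier_mat b a" "transpose_mat Z * Z = 1\<^sub>m a"
    and s: "dim_vec s = b" "\<And>j. j < b \<Longrightarrow> s $ j \<le> 0"
  shows "(\<Sum>j<b. s $ j) \<le> frob Z (S_of s * Z)"
proof -
  have [simp]: "dim_row Z = b" "dim_col Z = a" using Z by auto
  let ?Y = "transpose_mat U2 * Z"
  have "transpose_mat ?Y * ?Y = transpose_mat Z * (U2 * transpose_mat U2) * Z"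
    by (simp add: transpose_mult_dims mult_assoc_dims)
  then have "transpose_mat ?Y * ?Y = 1\<^sub>m a" using Z by (simp add: U2(6))
  then have row: "(\<Sum>i<a. (?Y $$ (j, i))\<^sup>2) \<le> 1" if "j < b" for j
    using that by (intro row_norm_le_one) (auto intro: carrier_matI)
  have "frob Z (S_of s * Z) = frob Z (U2 * (diag_of_vec s * ?Y))"
    using s by (simp add: mult_assoc_dims)
  also have "\<dots> = frob ?Y (diag_of_vec s * ?Y)"
    using s by (subst frob_mult_left_adjoint) auto
  also have "\<dots> = (\<Sum>j<b. s $ j * (\<Sum>i<a. (?Y $$ (j, i))\<^sup>2))"
    using s(1) by (simp add: frob_def diag_of_vec_mult_entry power2_eq_square sum_distrib_left mult_ac
        del: index_mult_mat(1))
  also have "\<dots> \<ge> (\<Sum>j<b. s $ j)"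
  proof (rule sum_mono)
    fix j assume "j \<in> {..<b}"
    then show "s $ j \<le> s $ j * (\<Sum>i<a. (?Y $$ (j, i))\<^sup>2)"
      using mult_left_mono_neg[OF row, of j "s $ j"] s(2) by simp
  qed
  finally show ?thesis .
qed

lemma frob_T_eq:
  assumes Z: "Z \<in> carrier_mat b a" "transpose_mat Z * Z = 1\<^sub>m a" and t: "dim_vec t = a"
  shows "frob Z (Z * T_of t) = (\<Sum>i<a. t $ i)"
proof -
  have [simp]: "dim_row Z = b" "dim_col Z = a" using Z by auto
  have "frob Z (Z * T_of t) = frob (transpose_mat Z * Z) (T_of t)"
    using t by (subst frob_mult_left_adjoint) auto
  also have "\<dots> = trace_mat (T_of t)"
    by (simp add: Z(2) trace_mat_eq_frob_one)
  also have "\<dots> = (\<Sum>i<a. t $ i)"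
    using t by (simp add: trace_diag_conjugate[OF t U1(1,5)] scalar_prod_def atLeast0LessThan)
  finally show ?thesis .
qed

end

lemma card_ordered_pairs_of_edges:
  assumes "finite F" "\<And>e. e \<in> F \<Longrightarrow> card e = 2"
  shows "card {(u, v). {u, v} \<in> F} = 2 * card F"
proof -
  have two: "card {(u, v). {u, v} = e} = 2" "finite {(u, v). {u, v} = e}" if e: "e \<in> F" for e
  proof -
    obtain x y where xy: "e = {x, y}" "x \<noteq> y" using assms(2)[OF e] by (auto simp: card_2_iff)
    then have "{(u, v). {u, v} = e} = {(x, y), (y, x)}" by (auto simp: doubleton_eq_iff)
    then show "card {(u, v). {u, v} = e} = 2" "finite {(u, v). {u, v} = e}" using xy by auto
  qed
  have "{(u, v). {u, v} \<in> F} = (\<Union>e\<in>F. {(u, v). {u, v} = e})" by auto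
  then have "card {(u, v). {u, v} \<in> F} = (\<Sum>e\<in>F. card {(u, v). {u, v} = e})"
    using assms(1) two by (simp add: card_UN_disjoint disjoint_iff)
  then show ?thesis using two by simp
qed

lemma simple_graph_finite: "simple_graph n E \<Longrightarrow> finite E"
  by (rule finite_subset[of _ "Pow {..<n}"]) (auto simp: simple_graph_def)

definition partition_mat :: "nat \<Rightarrow> nat \<Rightarrow> (nat \<Rightarrow> nat set) \<Rightarrow> real mat" where
  "partition_mat n k P = mat n k (\<lambda>(u, i). if u \<in> P i then 1 else 0)"

lemma dim_partition_mat [simp]: "dim_row (partition_mat n k P) = n" "dim_col (partition_mat n k P) = k"
  by (auto simp: partition_mat_def)

lemma ordered_partition_part:
  assumes "ordered_partition n m P"
  obtains p where "\<And>u i. u < n \<Longrightarrow> i < dim_vec m \<Longrightarrow> u \<in> P i \<longleftrightarrow> i = p u" "\<And>u. u < n \<Longrightarrow> p u < dim_vec m"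
proof -
  have "\<exists>i. i < dim_vec m \<and> u \<in> P i" if "u < n" for u
    using assms that by (auto simp: ordered_partition_def set_eq_iff)
  then obtain p where p: "\<And>u. u < n \<Longrightarrow> p u < dim_vec m \<and> u \<in> P (p u)" by metis
  show ?thesis
  proof (rule that[of p])
    show "u \<in> P i \<longleftrightarrow> i = p u" if "u < n" "i < dim_vec m" for u i
      using p[OF that(1)] assms that unfolding ordered_partition_def disjoint_family_on_def by blast
  qed (use p in auto)
qed

text \<open>Consecutive intervals of the prescribed lengths.\<close>

lemma ordered_partition_exists:
  assumes "(\<Sum>i<dim_vec m. m $ i) = n"
  shows "\<exists>P. ordered_partition n m P"
proof -
  define c where "c i = (\<Sum>l<i. m $ l)" for i
  have c: "c (Suc i) = c i + m $ i" "c 0 = 0" for i by (simp_all add: c_def)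
  have mono: "c i \<le> c j" if "i \<le> j" for i j using that by (auto simp: c_def intro!: sum_mono2)
  have un: "(\<Union>i<j. {c i..<c (Suc i)}) = {..<c j}" for j
  proof (induction j)
    case (Suc j)
    then show ?case using mono[of j "Suc j"] by (auto simp: lessThan_Suc)
  qed (simp add: c)
  have "{c i..<c (Suc i)} \<inter> {c j..<c (Suc j)} = {}" if "i \<noteq> j" for i j
    using mono[of "Suc i" j] mono[of "Suc j" i] that by (cases "i < j") auto
  then have "ordered_partition n m (\<lambda>i. {c i..<c (Suc i)})"
    using un[of "dim_vec m"] assms unfolding ordered_partition_def disjoint_family_on_def
    by (auto simp: c_def[of "dim_vec m"]) (simp_all add: c)
  then show ?thesis by blast
qed

text \<open>The diagonal perturbation of the adjacency matrix is invisible because \<^term>\<open>Bmat k\<close> has a zero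
  diagonal, and each cut edge is counted in both orientations.\<close>

lemma frob_partition_eq_cut:
  assumes P: "ordered_partition n m P" and E: "simple_graph n E" and d: "d \<in> carrier_vec n"
    and k: "k = dim_vec m" "k > 0" and G: "G = adjacency n E - diag_of_vec d"
  shows "frob (partition_mat n k P) (G * partition_mat n k P * Bmat k) = 2 * real (card (cut_edges E k P))"
proof -
  let ?X = "partition_mat n k P" and ?B = "Bmat k"
  have [simp]: "dim_row G = n" "dim_col G = n" using G d by (auto simp: adjacency_def)
  have [simp]: "dim_row ?B = k" "dim_col ?B = k" using Bmat_carrier[OF k(2)] by (auto simp del: Bmat_carrier)
  obtain p where p: "\<And>u i. u < n \<Longrightarrow> i < k \<Longrightarrow> u \<in> P i \<longleftrightarrow> i = p u" "\<And>u. u < n \<Longrightarrow> p u < k"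
    using ordered_partition_part[OF P] k(1) by blast
  have X: "?X $$ (u, i) = (if i = p u then 1 else 0)" if "u < n" "i < k" for u i
    using that p(1) by (simp add: partition_mat_def)
  have XBX: "(?X * ?B * transpose_mat ?X) $$ (u, v) = ?B $$ (p u, p v)" if "u < n" "v < n" for u v
  proof -
    have XB: "(?X * ?B) $$ (u, j) = ?B $$ (p u, j)" if j: "j < k" for j
    proof -
      have "(?X * ?B) $$ (u, j) = (\<Sum>i<k. ?X $$ (u, i) * ?B $$ (i, j))"
        using \<open>u < n\<close> j by (simp add: mult_mat_entry del: index_mult_mat(1))
      also have "\<dots> = (\<Sum>i<k. if i = p u then ?B $$ (i, j) else 0)"
        using \<open>u < n\<close> by (intro sum.cong) (simp_all add: X)
      finally show ?thesis using p(2)[OF \<open>u < n\<close>] by simp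
    qed
    have "(?X * ?B * transpose_mat ?X) $$ (u, v) = (\<Sum>j<k. (?X * ?B) $$ (u, j) * ?X $$ (v, j))"
      using that by (subst mult_mat_entry) (simp_all del: index_mult_mat(1))
    also have "\<dots> = (\<Sum>j<k. if j = p v then ?B $$ (p u, j) else 0)"
      using that by (intro sum.cong) (simp_all add: X XB del: index_mult_mat(1))
    finally show ?thesis using p(2)[OF \<open>v < n\<close>] by simp
  qed
  define A where "A = {(u, v). u < n \<and> v < n \<and> {u, v} \<in> E \<and> p u \<noteq> p v \<and> p u < k - 1 \<and> p v < k - 1}"
  have ent: "?B $$ (p u, p v) * G $$ (u, v) = (if (u, v) \<in> A then 1 else 0)" if "u < n" "v < n" for u v
    using that d p(2)[of u] p(2)[of v] by (auto simp: G A_def Bmat_entry adjacency_def)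
  have "frob ?X (G * ?X * ?B) = frob (?X * transpose_mat ?B) (G * ?X)"
    by (subst frob_mult_right_adjoint) auto
  also have "\<dots> = frob (?X * ?B * transpose_mat ?X) G"
    by (subst frob_mult_right_adjoint) (auto simp: Bmat_symmetric[OF k(2)])
  also have "\<dots> = (\<Sum>u<n. \<Sum>v<n. if (u, v) \<in> A then 1 else 0)"
    by (simp add: frob_def XBX ent del: index_mult_mat(1))
  also have "\<dots> = (\<Sum>q\<in>{..<n} \<times> {..<n}. if q \<in> A then 1 else 0)"
    by (simp add: sum.cartesian_product split_beta)
  also have "\<dots> = real (card A)"
  proof -
    have "({..<n} \<times> {..<n}) \<inter> {q. q \<in> A} = A" by (auto simp: A_def)
    then show ?thesis by (simp add: sum.If_cases)
  qed
  also have "A = {(u, v). {u, v} \<in> cut_edges E k P}"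
  proof -
    have vert: "u < n" "v < n" if "{u, v} \<in> E" for u v
      using E that by (auto simp: simple_graph_def)
    have "{u, v} \<in> cut_edges E k P \<longleftrightarrow> (u, v) \<in> A" if uv: "{u, v} \<in> E" for u v
    proof
      assume "{u, v} \<in> cut_edges E k P"
      then obtain i j u' v' where h: "i < k - 1" "j < k - 1" "i \<noteq> j" "u' \<in> P i" "v' \<in> P j" "{u, v} = {u', v'}"
        by (auto simp: cut_edges_def)
      have "(u' = u \<and> v' = v) \<or> (u' = v \<and> v' = u)" using h(6) by (auto simp: doubleton_eq_iff)
      then show "(u, v) \<in> A"
        using h(1-5) p(1)[of u i] p(1)[of v j] p(1)[of v i] p(1)[of u j] vert[OF uv] uv
        by (auto simp: A_def)
    next
      assume "(u, v) \<in> A"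
      then have "u \<in> P (p u)" "v \<in> P (p v)" "p u < k - 1" "p v < k - 1" "p u \<noteq> p v"
        using p by (auto simp: A_def)
      then show "{u, v} \<in> cut_edges E k P" using uv unfolding cut_edges_def by blast
    qed
    moreover have "{u, v} \<in> E" if "{u, v} \<in> cut_edges E k P \<or> (u, v) \<in> A" for u v
      using that by (auto simp: A_def cut_edges_def)
    ultimately show ?thesis by auto
  qed
  also have "card \<dots> = 2 * card (cut_edges E k P)"
    by (rule card_ordered_pairs_of_edges)
      (use E simple_graph_finite[OF E] in \<open>auto simp: cut_edges_def simple_graph_def\<close>)
  finally show ?thesis by simp
qed

context partition_bases
begin

lemma partition_mat_in_nonneg_set:
  assumes P: "ordered_partition n m P"
  shows "partition_mat n k P \<in> nonneg_set n m"
    and "transpose_mat (partition_mat n k P) * partition_mat n k P = Mt * Mt"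
proof -
  let ?X = "partition_mat n k P"
  obtain p where p: "\<And>u i. u < n \<Longrightarrow> i < k \<Longrightarrow> u \<in> P i \<longleftrightarrow> i = p u" "\<And>u. u < n \<Longrightarrow> p u < k"
    using ordered_partition_part[OF P] by auto
  have X: "?X $$ (u, i) = (if i = p u then 1 else 0)" if "u < n" "i < k" for u i
    using that p(1) by (simp add: partition_mat_def)
  have part: "P i = {u\<in>{..<n}. p u = i}" if "i < k" for i
    using P p(1)[OF _ that] that by (auto simp: ordered_partition_def set_eq_iff)
  have col: "(\<Sum>u<n. if i = p u then 1 else 0) = real (m $ i)" if "i < k" for i
  proof -
    have "(\<Sum>u<n. if i = p u then 1 else 0) = real (card (P i))"
      by (simp add: sum.If_cases part[OF that] Int_def) (intro arg_cong[of _ _ card], auto)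
    then show ?thesis using P that by (simp add: ordered_partition_def)
  qed
  have "?X *\<^sub>v ones_vec k = ones_vec n"
  proof (rule eq_vecI)
    fix u assume "u < dim_vec (ones_vec n)"
    then show "(?X *\<^sub>v ones_vec k) $ u = ones_vec n $ u"
      using p(2)[of u] by (simp add: scalar_prod_def atLeast0LessThan X)
  qed simp
  moreover have "transpose_mat ?X *\<^sub>v ones_vec n = real_vec m"
  proof (rule eq_vecI)
    fix i assume "i < dim_vec (real_vec m)"
    then show "(transpose_mat ?X *\<^sub>v ones_vec n) $ i = real_vec m $ i"
      using col[of i] by (simp add: scalar_prod_def atLeast0LessThan X)
  qed simp
  ultimately show "?X \<in> nonneg_set n m"
    by (auto simp: nonneg_set_def affine_set_def X intro: carrier_matI)
  show "transpose_mat ?X * ?X = Mt * Mt"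
  proof (rule eq_matI)
    fix i j assume "i < dim_row (Mt * Mt)" "j < dim_col (Mt * Mt)"
    then have ij: "i < k" "j < k" by auto
    have "(transpose_mat ?X * ?X) $$ (i, j) = (\<Sum>u<n. ?X $$ (u, i) * ?X $$ (u, j))"
      using ij by (simp add: mult_mat_entry del: index_mult_mat(1))
    also have "\<dots> = (\<Sum>u<n. if i = j then (if i = p u then 1 else 0) else 0)"
      using ij by (intro sum.cong) (auto simp: X)
    also have "\<dots> = (if i = j then real (m $ i) else 0)"
      using col[OF ij(1)] by (cases "i = j") auto
    also have "\<dots> = (Mt * Mt) $$ (i, j)"
      using ij by (simp add: Mtilde_def diag_of_vec_mult_entry del: index_mult_mat(1))
    finally show "(transpose_mat ?X * ?X) $$ (i, j) = (Mt * Mt) $$ (i, j)" .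
  qed auto
qed

text \<open>Since \<open>V Z = X \<mu>\<^sup>-\<^sup>1 W\<close>, the scaling by \<open>\<mu>\<^sup>-\<^sup>1\<close> on both sides cancels \<open>X\<^sup>T X = \<mu>\<^sup>2\<close>.\<close>

lemma partition_coordinates_orthonormal:
  assumes X: "X \<in> affine_set n m" "transpose_mat X * X = Mt * Mt"
  defines "Z \<equiv> Vt * X * Mt_inv * W"
  shows "transpose_mat Z * Z = 1\<^sub>m (k - 1)"
proof -
  have [simp]: "dim_row X = n" "dim_col X = k" using X by (auto simp: affine_set_def)
  have Z: "Z \<in> carrier_mat (n - 1) (k - 1)" by (auto simp: Z_def intro: carrier_matI)
  then have [simp]: "dim_row Z = n - 1" "dim_col Z = k - 1" by auto
  have VZ: "V * Z = X * Mt_inv * W"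
    using embed_Mt_inv_W[OF Z, of 1] affine_set_eq_embed[OF X(1)] by (simp add: Z_def)
  have "transpose_mat Z * Z = transpose_mat Z * (Vt * V) * Z" by (simp add: VtV)
  also have "\<dots> = transpose_mat (V * Z) * (V * Z)" by (simp add: transpose_mult_dims mult_assoc_dims)
  also have "\<dots> = Wt * Mt_inv * (transpose_mat X * X) * Mt_inv * W"
    unfolding VZ by (simp add: transpose_mult_dims mult_assoc_dims)
  also have "\<dots> = Wt * (Mt_inv * Mt) * (Mt * Mt_inv) * W"
    unfolding X(2) by (simp add: mult_assoc_dims)
  also have "\<dots> = 1\<^sub>m (k - 1)" by (simp add: Mt_inv_Mt Mt_Mt_inv WtW)
  finally show ?thesis .
qed

end

section \<open>The lower bound\<close>

lemma adjacency_minus_diag_symmetric: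
  assumes "d \<in> carrier_vec n"
  shows "adjacency n E - diag_of_vec d \<in> sym_mat n"
  using assms
  by (auto simp: sym_mat_def adjacency_def insert_commute intro!: carrier_matI eq_matI)

context partition_bases
begin

lemma k_le_n: "k \<le> n"
proof -
  have "(\<Sum>i<k. 1) \<le> (\<Sum>i<k. m $ i)" using m_pos by (intro sum_mono) (simp add: Suc_leI)
  then show ?thesis using m_sum by simp
qed

text \<open>The corrections by \<open>S\<close> and \<open>T\<close> subtract at least \<open>2 * lp_objective s t\<close>, which absorbs the
  eigenvalue term.\<close>

lemma Qtilde_partition_le_cut:
  assumes P: "ordered_partition n m P" and E: "simple_graph n E" and d: "d \<in> carrier_vec n"
    and G: "G = adjacency n E - diag_of_vec d"
    and U1: "eig_decomp (Bhat m W) U1 lam" and U2: "eig_decomp (Ghat V G) U2 sig"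
    and lp: "lp_optimal lam sig s t"
    and S: "S = U2 * diag_of_vec s * transpose_mat U2" and T: "T = U1 * diag_of_vec t * transpose_mat U1"
  shows "1/2 * quad_form (Qtilde n m G V W S T) (vec_stack (partition_mat n k P))
      + 1/2 * eig_term (Ghat V G) (Bhat m W) \<le> real (card (cut_edges E k P))"
proof -
  interpret sp: spectral_pair "k - 1" "n - 1" "Bhat m W" "Ghat V G" U1 U2 lam sig
    by unfold_locales (use U1 U2 in \<open>auto simp: Bhat_def Ghat_def\<close>)
  have Gs: "G \<in> sym_mat n" unfolding G using d by (rule adjacency_minus_diag_symmetric)
  have f: "(s, t) \<in> lp_feasible lam sig" using lp by (simp add: lp_optimal_def)
  then have st: "dim_vec s = n - 1" "dim_vec t = k - 1" "\<And>j. j < n - 1 \<Longrightarrow> s $ j \<le> 0"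
    by (auto simp: lp_feasible_def)
  have Ss: "S \<in> carrier_mat (n - 1) (n - 1)" and Ts: "T \<in> sym_mat (k - 1)"
    using diag_conjugate_symmetric[OF sp.U2(1) st(1)] diag_conjugate_symmetric[OF sp.U1(1) st(2)]
    by (auto simp: S T sym_mat_def)
  let ?X = "partition_mat n k P"
  define Z where "Z = Vt * ?X * Mt_inv * W"
  have Z: "Z \<in> carrier_mat (n - 1) (k - 1)" by (auto simp: Z_def intro: carrier_matI)
  have X: "?X \<in> affine_set n m" "?X = embed 1 Z"
    using partition_mat_in_nonneg_set(1)[OF P] affine_set_eq_embed[of ?X]
    by (auto simp: nonneg_set_def Z_def)
  have ZZ: "transpose_mat Z * Z = 1\<^sub>m (k - 1)"
    unfolding Z_def by (rule partition_coordinates_orthonormal[OF X(1) partition_mat_in_nonneg_set(2)[OF P]])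
  have "quad_form (Qtilde n m G V W S T) (vec_stack ?X)
      = frob ?X (G * ?X * B) - frob Z (S * Z) - frob Z (Z * T)"
    using Ts Vt_embed_Mt_inv[OF Z, of 1] embed_Mt_inv_W[OF Z, of 1] frob_mult_Wt[OF Ss Z] frob_V_mult[OF _ Z, of T]
    by (subst quad_form_Qtilde[OF Gs Ss Ts]) (auto simp: sym_mat_def simp flip: X(2) intro: carrier_matI)
  moreover have "frob ?X (G * ?X * B) = 2 * real (card (cut_edges E k P))"
    by (rule frob_partition_eq_cut[OF P E d _ k_pos G]) simp
  moreover have "(\<Sum>j<n - 1. s $ j) \<le> frob Z (S * Z)"
    unfolding S by (rule sp.frob_S_lower[OF Z ZZ st(1,3)])
  moreover have "frob Z (Z * T) = (\<Sum>i<k - 1. t $ i)"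
    unfolding T by (rule sp.frob_T_eq[OF Z ZZ st(2)])
  moreover have "eig_term (Ghat V G) (Bhat m W) \<le> (\<Sum>j<n - 1. s $ j) + (\<Sum>i<k - 1. t $ i)"
    using sp.eig_term_le_lp[OF _ lp] k_le_n st by (simp add: sp.lp_objective_eq_sum diff_le_mono)
  ultimately show ?thesis by linarith
qed

lemma min_cut_attained:
  assumes "simple_graph n E"
  obtains P where "ordered_partition n m P" "min_cut n E m = card (cut_edges E k P)"
proof -
  let ?A = "{card (cut_edges E (dim_vec m) P) | P. ordered_partition n m P}"
  have "?A \<subseteq> {..card E}"
    using simple_graph_finite[OF assms] by (auto simp: cut_edges_def intro: card_mono)
  then have "finite ?A" by (rule finite_subset) simp
  moreover have "?A \<noteq> {}" using ordered_partition_exists[of m n] m_sum by auto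
  ultimately have "Min ?A \<in> ?A" by (rule Min_in)
  then show ?thesis using that by (auto simp: min_cut_def)
qed

lemma tangent_eq_embed:
  assumes "Y \<in> tangent_space n k"
  shows "Y = embed 0 (Vt * Y * Mt_inv * W)"
proof -
  have "dim_row Y = n" "dim_col Y = k" using assms by (auto simp: tangent_space_def)
  moreover have "0 \<cdot>\<^sub>m Xhat n m + K = K" if "dim_row K = n" "dim_col K = k" for K
    using that by (intro eq_matI) auto
  ultimately show ?thesis
    using tangent_decomposition[OF assms] by (simp add: embed_def)
qed

end

theorem theorem4p1:
  fixes n k :: nat and m :: "nat vec" and E :: "nat set set" and d :: "real vec"
    and G V W U1 U2 S T :: "real mat" and lam sig s t :: "real vec"
  assumes k: "k > 2"
    and m: "m \<in> carrier_vec k" "\<forall>i<k. m $ i > 0" "(\<Sum>i<k. m $ i) = n"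
    and E: "simple_graph n E" "E \<noteq> {}"
    and V: "V \<in> carrier_mat n (n - 1)"
      "orthogonal_matrix (prepend_col ((1 / sqrt (real n)) \<cdot>\<^sub>v ones_vec n) V)"
    and W: "W \<in> carrier_mat k (k - 1)"
      "orthogonal_matrix (prepend_col ((1 / sqrt (real n)) \<cdot>\<^sub>v sqrt_vec m) W)"
    and d: "d \<in> carrier_vec n"
    and G: "G = adjacency n E - diag_of_vec d"
    and U1: "eig_decomp (Bhat m W) U1 lam"
    and U2: "eig_decomp (Ghat V G) U2 sig"
    and lp: "lp_optimal lam sig s t"
    and S: "S = U2 * diag_of_vec s * transpose_mat U2"
    and T: "T = U1 * diag_of_vec t * transpose_mat U1"
  shows "sdp_optimal (Bhat m W) (Ghat V G) S T
    \<and> real (min_cut n E m) \<ge> p_QP n m G V W S T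
    \<and> is_min_value (p_QP n m G V W S T) (qp_objective n m G V W S T) (qp_feasible n m V W)
    \<and> is_min_value (p_QP n m G V W S T)
        (\<lambda>X. 1/2 * quad_form (Qtilde n m G V W S T) (vec_stack X)
              + 1/2 * eig_term (Ghat V G) (Bhat m W))
        (nonneg_set n m)
    \<and> (\<forall>Y \<in> tangent_space n k. quad_form (Qtilde n m G V W S T) (vec_stack Y) \<ge> 0)"
proof -
  interpret partition_bases n k m V W
    using k m V W by unfold_locales auto
  interpret sp: spectral_pair "k - 1" "n - 1" "Bhat m W" "Ghat V G" U1 U2 lam sig
    by unfold_locales (use U1 U2 in \<open>auto simp: Bhat_def Ghat_def\<close>)
  let ?Q = "Qtilde n m G V W S T"
  let ?f = "\<lambda>X. 1/2 * quad_form ?Q (vec_stack X) + 1/2 * eig_term (Ghat V G) (Bhat m W)"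
  let ?F = "qp_objective n m G V W S T"
  let ?p = "p_QP n m G V W S T"
  have Gs: "G \<in> sym_mat n" unfolding G using d by (rule adjacency_minus_diag_symmetric)
  have f: "(s, t) \<in> lp_feasible lam sig" using lp by (simp add: lp_optimal_def)
  then have st: "dim_vec s = n - 1" "dim_vec t = k - 1"
    by (auto simp: lp_feasible_def)
  have Ss: "S \<in> carrier_mat (n - 1) (n - 1)" and Ts: "T \<in> sym_mat (k - 1)"
    using diag_conjugate_symmetric[OF sp.U2(1) st(1)] diag_conjugate_symmetric[OF sp.U1(1) st(2)]
    by (auto simp: S T sym_mat_def)
  obtain P where P: "ordered_partition n m P" "min_cut n E m = card (cut_edges E k P)"
    using min_cut_attained[OF E(1)] by blast
  note XP = partition_mat_in_nonneg_set(1)[OF P(1)]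

  have "dim_row ?Q = n * dim_vec m" "dim_col ?Q = n * dim_vec m"
    by (auto simp: Qtilde_def inv_mat_Mtilde)
  then obtain X0 where X0: "X0 \<in> nonneg_set n m"
    and min0: "\<And>X. X \<in> nonneg_set n m \<Longrightarrow> quad_form ?Q (vec_stack X0) \<le> quad_form ?Q (vec_stack X)"
    using quad_form_attains_min[of ?Q n m] XP by blast
  have min: "?f X0 \<le> ?f X" if "X \<in> nonneg_set n m" for X
    using min0[OF that] by simp
  define Z0 where "Z0 = Vt * X0 * Mt_inv * W"
  have Z0c: "Z0 \<in> carrier_mat (n - 1) (k - 1)" by (auto simp: Z0_def intro: carrier_matI)
  have X0e: "X0 = embed 1 Z0"
    unfolding Z0_def using X0 by (intro affine_set_eq_embed) (simp add: nonneg_set_def)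
  have Ff: "?F Z = ?f (embed 1 Z)" and emb: "embed 1 Z \<in> nonneg_set n m" if "Z \<in> qp_feasible n m V W" for Z
    using that qp_objective_eq[OF Gs Ss Ts, of Z] by (auto simp: qp_feasible_iff)
  have Z0: "Z0 \<in> qp_feasible n m V W" using Z0c X0 by (simp add: qp_feasible_iff X0e)
  have F0: "?F Z0 = ?f X0" using Ff[OF Z0] by (simp add: X0e)
  have minF: "?F Z0 \<le> ?F Z" if "Z \<in> qp_feasible n m V W" for Z
    using min[OF emb[OF that]] Ff[OF that] F0 by simp
  have p: "?p = ?F Z0"
    unfolding p_QP_def using Z0 minF by (intro cInf_eq_minimum) auto

  have "sdp_optimal (Bhat m W) (Ghat V G) S T"
    unfolding S T by (rule sp.sdp_optimal_diag[OF lp])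
  moreover have "real (min_cut n E m) \<ge> ?p"
    using Qtilde_partition_le_cut[OF P(1) E(1) d G U1 U2 lp S T] min[OF XP] p F0 P(2) by simp
  moreover have "is_min_value ?p ?F (qp_feasible n m V W)"
    unfolding is_min_value_def using p Z0 minF by auto
  moreover have "is_min_value ?p ?f (nonneg_set n m)"
    unfolding is_min_value_def using p F0 X0 min by auto
  moreover have "\<forall>Y \<in> tangent_space n k. quad_form ?Q (vec_stack Y) \<ge> 0"
  proof
    fix Y assume Y: "Y \<in> tangent_space n k"
    let ?Z = "Vt * Y * Mt_inv * W"
    have Z: "?Z \<in> carrier_mat (n - 1) (k - 1)" by (auto intro: carrier_matI)
    have "quad_form ?Q (vec_stack Y) = quad_form (Qhat (Bhat m W) (Ghat V G) S T) (vec_stack ?Z)"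
      using quad_form_Qtilde_embed[OF Gs Ss Ts Z, of 0] tangent_eq_embed[OF Y] by simp
    also have "\<dots> \<ge> 0"
      unfolding S T by (rule sp.quad_form_Qhat_nonneg[OF f Z])
    finally show "quad_form ?Q (vec_stack Y) \<ge> 0" .
  qed
  ultimately show ?thesis by blast
qed

end
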